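(* Let $r=0$, $q=1$, and $g_h \in \Sigma_{h+}$ (so $g_h$ is a piecewise constant positive definite Regge metric on the triangulation $\mathcal{T}_h$). For every $i=1,2,\dots,N_0$, we have $$\langle \kappa_h(g_h), \phi_i \rangle_{g_h} = 2\pi - \sum_{K \in \omega_i} \theta_{iK},$$ where $\omega_i$ is the set of triangles in $\mathcal{T}_h$ sharing vertex $i$ (i.e. having $y^{(i)}$ as a vertex), and $\theta_{iK}$ is the interior angle of $K$ at vertex $i$ as measured by $g_h$.
   Context: Setting. $\Omega\subset\mathbb{R}^2$ is a polygonal domain, $\mathbb{S}=\{\sigma\in\mathbb{R}^{2\times2}\mid\sigma=\sigma^T\}$, $\delta$ is the $2\times2$ identity matrix (the Euclidean metric), and $\mathcal{T}_h$ is a triangulation of $\Omega$. $\mathcal{E}_h$ is the set of edges of $\mathcal{T}_h$ and $\mathring{\mathcal{E}}_h$ the set of edges not contained in $\partial\Omega$. The vertices of $\mathcal{T}_h$ are $\{y^{(i)}\}_{i=1}^N$, enumerated so that $y^{(i)}\notin\partial\Omega$ if and only if $1\le i\le N_0<N$. Spaces. $V=\{v\in H^1_0(\Omega)\mid v|_K\in H^2(K)\ \forall K\in\mathcal{T}_h\}$. $\Sigma$ is the set of $\sigma\in L^2(\Omega)\otimes\mathbb{S}$ with $\sigma|_K\in H^1(K)\otimes\mathbb{S}$ for all $K\in\mathcal{T}_h$ and $\tau^T\sigma\tau$ continuous across every $e\in\mathring{\mathcal{E}}_h$ ($\tau$ a Euclidean unit tangent to $e$). $V_h=\{v\in V\mid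 v|_K\in\mathcal{P}_q(K)\ \forall K\}$ and $\Sigma_h=\{\sigma\in\Sigma\mid\sigma|_K\in\mathcal{P}_r(K)\otimes\mathbb{S}\ \forall K\}$, where $\mathcal{P}_j(K)$ denotes polynomials of degree $\le j$. $\Sigma_{h+}=\{\sigma\in\Sigma_h\mid\sigma(x)\succ0\ \forall x\in\mathring{K},\ \forall K\in\mathcal{T}_h\}$. For $q=1$, $\{\phi_i\}_{i=1}^{N_0}$ is the basis of $V_h$ with $\phi_i(y^{(j)})=1$ if $i=j$ and $0$ if $i\ne j$, $j=1,\dots,N$. The form $b_h$. Let $g$ be a metric (possibly discontinuous across edges, in which case all quantities are computed elementwise, using traces from the element under consideration). On an edge of $K$ let $n$ be the Euclidean outward unit normal, $J=\begin{pmatrix}0&1\\-1&0\end{pmatrix}$, $\tau=-Jn$, $\tau_g=\tau/\sqrt{\tau^Tg\tau}$, $n_g=Jg\tau/(\sqrt{\tau^Tg\tau}\sqrt{\det g})$. Put $S_g\sigma=\sigma-g\operatorname{Tr}(g^{-1}\sigma)$, $(\operatorname{Hess}_gv)_{ij}=\partial_i\partial_jv-\Gamma^k_{ij}\partial_kv$ with $\Gamma^k_{ij}=\frac12 g^{k\ell}(\partial_j g_{\ell i}+\partial_i g_{\ell j}-\partial_\ell g_{ij})$, $\nabla_gv=g^{-1}\nabla v$, $\frac{\partial v}{\partial n_g}=n_g^Tg\nabla_gv$. For an edge $e=K_1\cap K_2\in\mathring{\mathcal{E}}_h$, $\llbracket w\rrbracket=w|_{\partial K_1}+w|_{\partial K_2}$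 (each term using the outward normal of its own triangle); for $e\subset\partial\Omega$, $\llbracket w\rrbracket=w|_{\partial\Omega}$. Then for $\sigma\in\Sigma$, $v\in V$, $$b_h(g;\sigma,v)=\sum_{K\in\mathcal{T}_h}\langle S_g\sigma,\operatorname{Hess}_gv\rangle_{g,K}+\sum_{e\in\mathcal{E}_h}\Big\langle\tau_g^T\sigma\tau_g,\Big\llbracket\frac{\partial v}{\partial n_g}\Big\rrbracket\Big\rangle_{g,e},$$ where $\langle\sigma,\rho\rangle_{g,K}=\int_K\operatorname{Tr}(g^{-1}\sigma g^{-1}\rho)\sqrt{\det g}\,dx$ and $\langle u,w\rangle_{g,e}=\int_e uw\sqrt{\tau^Tg\tau}\,d\ell$. Discrete curvature. $\langle u,v\rangle_g=\int_\Omega uv\sqrt{\det g}\,dx$. For $g_h\in\Sigma_{h+}$, the discrete Gaussian curvature $\kappa_h(g_h)$ is the unique element of $V_h$ with $\langle\kappa_h(g_h),v_h\rangle_{g_h}=\frac12\int_0^1b_h((1-t)\delta+tg_h;\,g_h-\delta,\,v_h)\,dt$ for all $v_h\in V_h$. Angles. If $u,w\in\mathbb{R}^2$ are the edge vectors of $K$ emanating from $y^{(i)}$ and $A$ is the constant value of $g_h$ on $K$, the angle of $K$ at vertex $i$ measured by $g_h$ is $\theta_{iK}=\arccos\big(u^TAw/(\sqrt{u^TAu}\sqrt{w^TAw})\big)\in(0,\pi)$. *)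

theory Defs
  imports "HOL-Analysis.Analysis"
begin

type_synonym plane = "real^2"
type_synonym mat2 = "real^2^2"


section \<open>Sobolev spaces and polynomials\<close>

definition L2 :: "plane set \<Rightarrow> (plane \<Rightarrow> real) set" where
  "L2 U = {u. u \<in> borel_measurable (lebesgue_on U) \<and> integrable (lebesgue_on U) (\<lambda>x. (u x)\<^sup>2)}"

definition partial :: "2 \<Rightarrow> (plane \<Rightarrow> real) \<Rightarrow> plane \<Rightarrow> real" where
  "partial i u x = frechet_derivative u (at x) (axis i 1)"

text \<open>\<open>Ck_on k U u\<close>: \<open>u\<close> is of class \<open>C\<^sup>k\<close> on the open set \<open>U\<close>.\<close>

primrec Ck_on :: "nat \<Rightarrow> plane set \<Rightarrow> (plane \<Rightarrow> real) \<Rightarrow> bool" where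
  "Ck_on 0 U u \<longleftrightarrow> continuous_on U u"
| "Ck_on (Suc k) U u \<longleftrightarrow> (\<forall>x\<in>U. u differentiable (at x)) \<and> (\<forall>i. Ck_on k U (partial i u))"

definition test_functions :: "plane set \<Rightarrow> (plane \<Rightarrow> real) set" where
  "test_functions U =
    {\<psi>. (\<forall>k. Ck_on k UNIV \<psi>) \<and> compact (closure {x. \<psi> x \<noteq> 0}) \<and> closure {x. \<psi> x \<noteq> 0} \<subseteq> U}"

definition weak_partial :: "plane set \<Rightarrow> 2 \<Rightarrow> (plane \<Rightarrow> real) \<Rightarrow> (plane \<Rightarrow> real) \<Rightarrow> bool" where
  "weak_partial U i u w \<longleftrightarrow> u \<in> L2 U \<and> w \<in> L2 U \<and>
    (\<forall>\<psi>\<in>test_functions U.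
       (LINT x|lebesgue_on U. u x * partial i \<psi> x) = - (LINT x|lebesgue_on U. w x * \<psi> x))"

text \<open>\<open>sobolev m U\<close> is \<open>H\<^sup>m(U)\<close>.\<close>

primrec sobolev :: "nat \<Rightarrow> plane set \<Rightarrow> (plane \<Rightarrow> real) set" where
  "sobolev 0 U = L2 U"
| "sobolev (Suc m) U = {u \<in> L2 U. \<forall>i. \<exists>w\<in>sobolev m U. weak_partial U i u w}"

text \<open>\<open>H\<^sup>1\<^sub>0(U)\<close>: the closure of the test functions in the norm of \<open>H\<^sup>1(U)\<close>.\<close>

definition H10 :: "plane set \<Rightarrow> (plane \<Rightarrow> real) set" where
  "H10 U = {u. \<exists>w. (\<forall>i. weak_partial U i u (w i)) \<and>
     (\<forall>\<epsilon>>0. \<exists>\<psi>\<in>test_functions U.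
        (LINT x|lebesgue_on U. (u x - \<psi> x)\<^sup>2)
        + (\<Sum>i\<in>UNIV. LINT x|lebesgue_on U. (w i x - partial i \<psi> x)\<^sup>2) < \<epsilon>)}"

text \<open>The weak partial derivative as an operator. It is determined only almost everywhere; for
  functions of class \<open>C\<^sup>1\<close> on \<open>U\<close> the classical derivative is taken as its representative.\<close>

definition pd :: "plane set \<Rightarrow> 2 \<Rightarrow> (plane \<Rightarrow> real) \<Rightarrow> plane \<Rightarrow> real" where
  "pd U i u = (if Ck_on 1 U u then partial i u else (SOME w. weak_partial U i u w))"

text \<open>The trace of \<open>u \<in> H\<^sup>1(K)\<close> at a boundary point of \<open>K\<close> is the limit of the means of \<open>u\<close> over
  \<open>K \<inter> B(x,r)\<close>. For a Lipschitz set such as a triangle this agrees almost everywhere on the boundary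
  with the Sobolev trace, and it does not depend on the representative of \<open>u\<close>.\<close>

definition tr :: "plane set \<Rightarrow> (plane \<Rightarrow> real) \<Rightarrow> plane \<Rightarrow> real" where
  "tr K u x = Lim (at_right 0)
     (\<lambda>r. (LINT y|lebesgue_on (interior K \<inter> ball x r). u y) / measure lebesgue (interior K \<inter> ball x r))"

definition mtr :: "plane set \<Rightarrow> (plane \<Rightarrow> mat2) \<Rightarrow> plane \<Rightarrow> mat2" where
  "mtr K \<sigma> x = (\<chi> i j. tr K (\<lambda>y. \<sigma> y $ i $ j) x)"

definition polys :: "nat \<Rightarrow> (plane \<Rightarrow> real) set" where
  "polys q = {p. \<exists>c :: nat \<Rightarrow> nat \<Rightarrow> real.
     p = (\<lambda>x. \<Sum>a\<le>q. \<Sum>b\<le>q - a. c a b * (x $ 1) ^ a * (x $ 2) ^ b)}"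


section \<open>Polygonal domains and triangulations\<close>

text \<open>The condition \<open>interior (closure \<Omega>) = \<Omega>\<close> excludes slits, so that \<open>\<Omega>\<close> lies on one side only of
  each boundary edge.\<close>

definition polygonal_domain :: "plane set \<Rightarrow> bool" where
  "polygonal_domain \<Omega> \<longleftrightarrow> open \<Omega> \<and> connected \<Omega> \<and> bounded \<Omega> \<and> \<Omega> \<noteq> {} \<and> interior (closure \<Omega>) = \<Omega> \<and>
     (\<exists>S. finite S \<and> frontier \<Omega> = (\<Union>(a, b)\<in>S. closed_segment a b))"

text \<open>\<open>triangulation\<close> includes finiteness and that any two members meet in a common face; triangles
  are closed sets.\<close>

definition triangulates :: "plane set set \<Rightarrow> plane set \<Rightarrow> bool" where
  "triangulates T \<Omega> \<longleftrightarrow> triangulation T \<and> (\<forall>K\<in>T. 2 simplex K) \<and> \<Union>T = closure \<Omega>"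

definition edges :: "plane set set \<Rightarrow> plane set set" where
  "edges T = {e. \<exists>K\<in>T. e edge_of K}"

definition inner_edges :: "plane set set \<Rightarrow> plane set \<Rightarrow> plane set set" where
  "inner_edges T \<Omega> = {e \<in> edges T. \<not> e \<subseteq> frontier \<Omega>}"

definition vertices :: "plane set set \<Rightarrow> plane set" where
  "vertices T = {y. \<exists>K\<in>T. y extreme_point_of K}"

definition vertex_enumeration :: "plane set set \<Rightarrow> plane set \<Rightarrow> nat \<Rightarrow> nat \<Rightarrow> (nat \<Rightarrow> plane) \<Rightarrow> bool" where
  "vertex_enumeration T \<Omega> N0 N y \<longleftrightarrow> N0 < N \<and> bij_betw y {1..N} (vertices T) \<and>
     (\<forall>i\<in>{1..N}. y i \<notin> frontier \<Omega> \<longleftrightarrow> i \<le> N0)"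


section \<open>Finite element spaces\<close>

definition V_space :: "plane set \<Rightarrow> plane set set \<Rightarrow> (plane \<Rightarrow> real) set" where
  "V_space \<Omega> T = {v \<in> H10 \<Omega>. \<forall>K\<in>T. v \<in> sobolev 2 (interior K)}"

text \<open>The elements of \<open>V_space\<close> are representatives of classes modulo null sets. An element of the
  finite element space is represented by its unique representative that is polynomial on each closed
  triangle and vanishes outside \<open>\<Omega>\<close>. It is continuous, so that its nodal values make sense.\<close>

definition Vh :: "plane set \<Rightarrow> plane set set \<Rightarrow> nat \<Rightarrow> (plane \<Rightarrow> real) set" where
  "Vh \<Omega> T q = {v \<in> V_space \<Omega> T. (\<forall>K\<in>T. \<exists>p\<in>polys q. \<forall>x\<in>K. v x = p x) \<and> (\<forall>x. x \<notin> \<Omega> \<longrightarrow> v x = 0)}"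

definition Sigma_space :: "plane set \<Rightarrow> plane set set \<Rightarrow> (plane \<Rightarrow> mat2) set" where
  "Sigma_space \<Omega> T = {\<sigma>.
     (\<forall>x\<in>\<Omega>. transpose (\<sigma> x) = \<sigma> x) \<and>
     (\<forall>i j. (\<lambda>x. \<sigma> x $ i $ j) \<in> L2 \<Omega>) \<and>
     (\<forall>K\<in>T. \<forall>i j. (\<lambda>x. \<sigma> x $ i $ j) \<in> sobolev 1 (interior K)) \<and>
     (\<forall>a b. closed_segment a b \<in> inner_edges T \<Omega> \<longrightarrow>
       (\<forall>K1\<in>T. \<forall>K2\<in>T. closed_segment a b edge_of K1 \<and> closed_segment a b edge_of K2 \<longrightarrow>
         (AE s in lebesgue_on {0..1}.
            sgn (b - a) \<bullet> (mtr K1 \<sigma> (linepath a b s) *v sgn (b - a)) =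
            sgn (b - a) \<bullet> (mtr K2 \<sigma> (linepath a b s) *v sgn (b - a)))))}"

definition Sigma_h :: "plane set \<Rightarrow> plane set set \<Rightarrow> nat \<Rightarrow> (plane \<Rightarrow> mat2) set" where
  "Sigma_h \<Omega> T r = {\<sigma> \<in> Sigma_space \<Omega> T.
     \<forall>K\<in>T. \<forall>i j. \<exists>p\<in>polys r. \<forall>x\<in>interior K. \<sigma> x $ i $ j = p x}"

definition Sigma_h_plus :: "plane set \<Rightarrow> plane set set \<Rightarrow> nat \<Rightarrow> (plane \<Rightarrow> mat2) set" where
  "Sigma_h_plus \<Omega> T r = {\<sigma> \<in> Sigma_h \<Omega> T r.
     \<forall>K\<in>T. \<forall>x\<in>interior K. \<forall>w. w \<noteq> 0 \<longrightarrow> w \<bullet> (\<sigma> x *v w) > 0}"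

text \<open>The second conjunct says that \<open>\<phi> 1, \<dots>, \<phi> N0\<close> is a basis of the space: every element is a linear
  combination of them with unique coefficients.\<close>

definition nodal_basis ::
  "plane set \<Rightarrow> plane set set \<Rightarrow> nat \<Rightarrow> nat \<Rightarrow> (nat \<Rightarrow> plane) \<Rightarrow> (nat \<Rightarrow> plane \<Rightarrow> real) \<Rightarrow> bool" where
  "nodal_basis \<Omega> T N0 N y \<phi> \<longleftrightarrow>
     (\<forall>i\<in>{1..N0}. \<phi> i \<in> Vh \<Omega> T 1) \<and>
     bij_betw (\<lambda>c x. \<Sum>i=1..N0. c i * \<phi> i x) ({1..N0} \<rightarrow>\<^sub>E UNIV) (Vh \<Omega> T 1) \<and>
     (\<forall>i\<in>{1..N0}. \<forall>j\<in>{1..N}. \<phi> i (y j) = (if i = j then 1 else 0))"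


section \<open>Geometry of a metric on a triangle\<close>

definition Jmat :: mat2 where
  "Jmat = vector [vector [0, 1], vector [-1, 0]]"

definition S_op :: "mat2 \<Rightarrow> mat2 \<Rightarrow> mat2" where
  "S_op g \<sigma> = \<sigma> - trace (matrix_inv g ** \<sigma>) *\<^sub>R g"

definition christoffel :: "plane set \<Rightarrow> (plane \<Rightarrow> mat2) \<Rightarrow> plane \<Rightarrow> 2 \<Rightarrow> 2 \<Rightarrow> 2 \<Rightarrow> real" where
  "christoffel U g x k i j = (1/2) * (\<Sum>l\<in>UNIV. matrix_inv (g x) $ k $ l *
     (pd U j (\<lambda>z. g z $ l $ i) x + pd U i (\<lambda>z. g z $ l $ j) x - pd U l (\<lambda>z. g z $ i $ j) x))"

definition hess :: "plane set \<Rightarrow> (plane \<Rightarrow> mat2) \<Rightarrow> (plane \<Rightarrow> real) \<Rightarrow> plane \<Rightarrow> mat2" where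
  "hess U g v x = (\<chi> i j. pd U i (pd U j v) x - (\<Sum>k\<in>UNIV. christoffel U g x k i j * pd U k v x))"

definition inner_tri ::
  "(plane \<Rightarrow> mat2) \<Rightarrow> plane set \<Rightarrow> (plane \<Rightarrow> mat2) \<Rightarrow> (plane \<Rightarrow> mat2) \<Rightarrow> real" where
  "inner_tri g K \<sigma> \<rho> = (LINT x|lebesgue_on (interior K).
     trace (matrix_inv (g x) ** \<sigma> x ** matrix_inv (g x) ** \<rho> x) * sqrt (det (g x)))"

text \<open>Outward Euclidean unit normal to the triangle \<open>K\<close> on its edge \<open>e\<close>. The inequality forces \<open>n\<close>
  to be orthogonal to \<open>e\<close>, since \<open>e \<subseteq> K\<close>.\<close>

definition outer_normal :: "plane set \<Rightarrow> plane set \<Rightarrow> plane" where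
  "outer_normal K e = (THE n. norm n = 1 \<and> (\<forall>x\<in>e. \<forall>z\<in>K. n \<bullet> (z - x) \<le> 0))"

definition tangent :: "plane set \<Rightarrow> plane set \<Rightarrow> plane" where
  "tangent K e = - (Jmat *v outer_normal K e)"

definition g_tangent :: "mat2 \<Rightarrow> plane \<Rightarrow> plane" where
  "g_tangent g \<tau> = (1 / sqrt (\<tau> \<bullet> (g *v \<tau>))) *\<^sub>R \<tau>"

definition g_normal :: "mat2 \<Rightarrow> plane \<Rightarrow> plane" where
  "g_normal g \<tau> = (1 / (sqrt (\<tau> \<bullet> (g *v \<tau>)) * sqrt (det g))) *\<^sub>R (Jmat *v (g *v \<tau>))"

definition grad_trace :: "plane set \<Rightarrow> (plane \<Rightarrow> real) \<Rightarrow> plane \<Rightarrow> plane" where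
  "grad_trace K v x = (\<chi> i. tr K (pd (interior K) i v) x)"

text \<open>Trace on the edge \<open>e\<close>, taken from \<open>K\<close>, of the derivative of \<open>v\<close> along the outward \<open>g\<close>-normal.\<close>

definition normal_deriv ::
  "(plane \<Rightarrow> mat2) \<Rightarrow> (plane \<Rightarrow> real) \<Rightarrow> plane set \<Rightarrow> plane set \<Rightarrow> plane \<Rightarrow> real" where
  "normal_deriv g v e K x = (let G = mtr K g x in
     g_normal G (tangent K e) \<bullet> (G *v (matrix_inv G *v grad_trace K v x)))"

text \<open>The jump over \<open>e\<close> of a family of traces indexed by the triangles. On an edge contained in the
  boundary the sum has a single term.\<close>

definition jump :: "plane set set \<Rightarrow> plane set \<Rightarrow> (plane set \<Rightarrow> plane \<Rightarrow> real) \<Rightarrow> plane \<Rightarrow> real" where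
  "jump T e w x = (\<Sum>K | K \<in> T \<and> e edge_of K. w K x)"

definition edge_integral :: "plane set \<Rightarrow> (plane \<Rightarrow> real) \<Rightarrow> real" where
  "edge_integral e f = (let (a, b) = (SOME (a, b). e = closed_segment a b) in
     norm (b - a) * (LINT s|lebesgue_on {0..1}. f (linepath a b s)))"

text \<open>For metrics and tensors in \<open>Sigma_space\<close> the tangential-tangential component is single-valued on
  every edge, so that the two functions below do not depend on the triangle that is chosen.\<close>

definition side :: "plane set set \<Rightarrow> plane set \<Rightarrow> plane set" where
  "side T e = (SOME K. K \<in> T \<and> e edge_of K)"

definition tt_component ::
  "plane set set \<Rightarrow> (plane \<Rightarrow> mat2) \<Rightarrow> (plane \<Rightarrow> mat2) \<Rightarrow> plane set \<Rightarrow> plane \<Rightarrow> real" where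
  "tt_component T g \<sigma> e x = (let K = side T e; \<tau>g = g_tangent (mtr K g x) (tangent K e) in
     \<tau>g \<bullet> (mtr K \<sigma> x *v \<tau>g))"

definition length_density :: "plane set set \<Rightarrow> (plane \<Rightarrow> mat2) \<Rightarrow> plane set \<Rightarrow> plane \<Rightarrow> real" where
  "length_density T g e x = (let K = side T e; \<tau> = tangent K e in sqrt (\<tau> \<bullet> (mtr K g x *v \<tau>)))"

definition inner_edge ::
  "plane set set \<Rightarrow> (plane \<Rightarrow> mat2) \<Rightarrow> plane set \<Rightarrow> (plane \<Rightarrow> real) \<Rightarrow> (plane \<Rightarrow> real) \<Rightarrow> real" where
  "inner_edge T g e u w = edge_integral e (\<lambda>x. u x * w x * length_density T g e x)"


section \<open>The form \<open>b\<^sub>h\<close> and the discrete curvature\<close>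

definition bh ::
  "plane set set \<Rightarrow> (plane \<Rightarrow> mat2) \<Rightarrow> (plane \<Rightarrow> mat2) \<Rightarrow> (plane \<Rightarrow> real) \<Rightarrow> real" where
  "bh T g \<sigma> v =
     (\<Sum>K\<in>T. inner_tri g K (\<lambda>x. S_op (g x) (\<sigma> x)) (hess (interior K) g v)) +
     (\<Sum>e\<in>edges T. inner_edge T g e (tt_component T g \<sigma> e) (jump T e (normal_deriv g v e)))"

definition inner_dom ::
  "plane set \<Rightarrow> (plane \<Rightarrow> mat2) \<Rightarrow> (plane \<Rightarrow> real) \<Rightarrow> (plane \<Rightarrow> real) \<Rightarrow> real" where
  "inner_dom \<Omega> g u v = (LINT x|lebesgue_on \<Omega>. u x * v x * sqrt (det (g x)))"

definition discrete_curvature ::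
  "plane set \<Rightarrow> plane set set \<Rightarrow> nat \<Rightarrow> (plane \<Rightarrow> mat2) \<Rightarrow> plane \<Rightarrow> real" where
  "discrete_curvature \<Omega> T q g = (THE \<kappa>. \<kappa> \<in> Vh \<Omega> T q \<and>
     (\<forall>v\<in>Vh \<Omega> T q. inner_dom \<Omega> g \<kappa> v =
        (1/2) * (LINT t|lebesgue_on {0..1}.
           bh T (\<lambda>x. (1 - t) *\<^sub>R mat 1 + t *\<^sub>R g x) (\<lambda>x. g x - mat 1) v)))"


section \<open>Angles\<close>

definition cell_value :: "plane set \<Rightarrow> (plane \<Rightarrow> mat2) \<Rightarrow> mat2" where
  "cell_value K g = (THE A. \<forall>x\<in>interior K. g x = A)"

definition angle_at :: "mat2 \<Rightarrow> plane set \<Rightarrow> plane \<Rightarrow> real" where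
  "angle_at A K y = (THE \<theta>. \<exists>u w. K = convex hull {y, y + u, y + w} \<and>
     \<theta> = arccos (u \<bullet> (A *v w) / (sqrt (u \<bullet> (A *v u)) * sqrt (w \<bullet> (A *v w)))))"

end

theory Submission
  imports Defs
begin

text \<open>For a piecewise linear function the Hessian with respect to a piecewise constant metric vanishes,
  so that only the edge terms of the form survive. Regrouped by triangles, the edge terms of a hat
  function \<open>\<phi>\<^sub>i\<close> on a triangle at the vertex \<open>i\<close>, taken at the metric \<open>G = (1 - t) \<delta> + t g\<close> and the
  tensor \<open>g - \<delta>\<close>, add up to \<open>- 2\<close> times the derivative in \<open>t\<close> of the angle at \<open>i\<close> measured by \<open>G\<close>.
  The integral over \<open>t\<close> is therefore twice the sum of the Euclidean angles minus twice the sum of the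
  angles measured by \<open>g\<close>. The Euclidean angles add up to \<open>2 \<pi>\<close>, by comparing the area of a small
  disc around the vertex with the areas of its sectors.\<close>


section \<open>Triangles in the plane\<close>

text \<open>Regrouping by triangles is possible because the factor in front of the jump, the
  tangential-tangential component, has the same value from both sides of an edge. This continuity is
  imposed only on edges not contained in the frontier, and only almost everywhere, so an edge of two
  triangles must be shown to be interior. Here \<open>interior (closure \<Omega>) = \<Omega>\<close>
  enters. The factor \<open>- 2\<close> has a classical source. On an edge \<open>E\<close> the form
  is twice the logarithmic derivative of the length of \<open>E\<close> times a weight: the
  cotangent of the angle at the other end for the two edges at the vertex, and minus the sum of
  these two cotangents for the opposite edge. This is the variation formula for an angle of a
  triangle whose side lengths change. Comparing areas around a vertex makes a cyclic order of its
  triangles unnecessary. The curvature is a definite description, so existence and uniqueness have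
  to be established before anything can be said about it; both rest on the positive definite Gram
  matrix of the hat functions.\<close>

lemma inner_plane: "(x::plane) \<bullet> y = x$1 * y$1 + x$2 * y$2"
  by (simp add: inner_vec_def sum_2)

lemma plane_eq_iff: "(x::plane) = y \<longleftrightarrow> x$1 = y$1 \<and> x$2 = y$2"
  by (simp add: vec_eq_iff forall_2)

definition cross2 :: "plane \<Rightarrow> plane \<Rightarrow> real" where
  "cross2 u w = u$1 * w$2 - u$2 * w$1"

text \<open>Twice the signed area of the triangle, positive for counterclockwise order. It is affine
  in each vertex, so its sign tells on which side of the line through the other two that vertex
  lies.\<close>

definition orient :: "plane \<Rightarrow> plane \<Rightarrow> plane \<Rightarrow> real" where
  "orient a b c = cross2 (b - a) (c - a)"

lemmas orient_simps = orient_def cross2_def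

lemma orient_cycle: "orient b c a = orient a b c"
  by (simp add: orient_simps algebra_simps)

lemma orient_swap: "orient a c b = - orient a b c"
  by (simp add: orient_simps algebra_simps)

text \<open>Cramer's rule for the basis \<open>u\<close>, \<open>w\<close>.\<close>

lemma cross2_expand:
  assumes "cross2 u w \<noteq> 0"
  shows "x = (cross2 x w / cross2 u w) *\<^sub>R u + (cross2 u x / cross2 u w) *\<^sub>R w"
  using assms unfolding plane_eq_iff by (simp add: field_simps) (simp add: cross2_def algebra_simps)

text \<open>The expansion of \<open>v\<close> in the orthogonal frame of \<open>u\<close> and its
  rotation by ninety degrees; the factor \<open>u \<bullet> u\<close> avoids a division.\<close>

lemma cross2_decompose: "(u \<bullet> u) *\<^sub>R v = (v \<bullet> u) *\<^sub>R u + cross2 u v *\<^sub>R vector [- u$2, u$1]"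
  by (simp add: plane_eq_iff inner_plane cross2_def vector_2 algebra_simps)

text \<open>Divided by \<open>orient a b c\<close>, the three orientations are the barycentric
  coordinates of \<open>x\<close>; in particular they sum to one.\<close>

lemma mem_triangle_iff:
  assumes "orient a b c > 0"
  shows "x \<in> convex hull {a,b,c} \<longleftrightarrow> 0 \<le> orient x b c \<and> 0 \<le> orient a x c \<and> 0 \<le> orient a b x"
proof
  assume "x \<in> convex hull {a,b,c}"
  then obtain s t where st: "x = a + s *\<^sub>R (b - a) + t *\<^sub>R (c - a)" "0 \<le> s" "0 \<le> t" "s + t \<le> 1"
    unfolding convex_hull_3_alt by auto
  have "orient x b c = (1 - s - t) * orient a b c" "orient a x c = s * orient a b c"
    "orient a b x = t * orient a b c"
    unfolding st(1) by (simp_all add: orient_simps algebra_simps)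
  then show "0 \<le> orient x b c \<and> 0 \<le> orient a x c \<and> 0 \<le> orient a b x"
    using st assms by simp
next
  let ?D = "orient a b c"
  assume *: "0 \<le> orient x b c \<and> 0 \<le> orient a x c \<and> 0 \<le> orient a b x"
  have "x - a = (orient a x c / ?D) *\<^sub>R (b - a) + (orient a b x / ?D) *\<^sub>R (c - a)"
    using cross2_expand[of "b - a" "c - a" "x - a"] assms by (simp add: orient_def)
  then have "x = a + (orient a x c / ?D) *\<^sub>R (b - a) + (orient a b x / ?D) *\<^sub>R (c - a)"
    by (simp add: algebra_simps)
  moreover have "orient x b c + orient a x c + orient a b x = ?D"
    by (simp add: orient_simps algebra_simps)
  then have "orient a x c / ?D + orient a b x / ?D \<le> 1"
    using * assms by (simp add: field_simps)
  moreover have "0 \<le> orient a x c / ?D" "0 \<le> orient a b x / ?D"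
    using * assms by auto
  ultimately show "x \<in> convex hull {a,b,c}"
    unfolding convex_hull_3_alt by blast
qed

lemma orient_eq_0_collinear: "orient a b c = 0 \<longleftrightarrow> collinear {a,b,c}"
proof
  assume 0: "orient a b c = 0"
  show "collinear {a,b,c}"
  proof (cases "b = a")
    case False
    then have "c - a = (1 / ((b - a) \<bullet> (b - a))) *\<^sub>R (((b - a) \<bullet> (b - a)) *\<^sub>R (c - a))"
      by simp
    also have "\<dots> = (((c - a) \<bullet> (b - a)) / ((b - a) \<bullet> (b - a))) *\<^sub>R (b - a)"
      using 0 unfolding cross2_decompose[of "b - a" "c - a"] by (simp add: orient_def)
    finally have "c - a = (((c - a) \<bullet> (b - a)) / ((b - a) \<bullet> (b - a))) *\<^sub>R (b - a)" .
    then have "collinear {0, b - a, c - a}" unfolding collinear_lemma by blast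
    then show ?thesis using collinear_3[of b a c] by (simp add: insert_commute)
  qed simp
next
  assume "collinear {a,b,c}"
  then obtain u where u: "\<And>x y. x \<in> {a,b,c} \<Longrightarrow> y \<in> {a,b,c} \<Longrightarrow> \<exists>k. x - y = k *\<^sub>R u"
    unfolding collinear_def by blast
  obtain k where k: "b - a = k *\<^sub>R u" using u[of b a] by auto
  obtain l where l: "c - a = l *\<^sub>R u" using u[of c a] by auto
  show "orient a b c = 0" unfolding orient_def k l by (simp add: cross2_def)
qed

lemma orient_nondegenerate:
  assumes "orient a b c > 0"
  shows "a \<noteq> b" "b \<noteq> c" "c \<noteq> a" "\<not> affine_dependent {a,b,c}"
proof -
  have "\<not> collinear {a,b,c}" using assms orient_eq_0_collinear[of a b c] by auto
  then show "a \<noteq> b" "b \<noteq> c" "c \<noteq> a" "\<not> affine_dependent {a,b,c}"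
    unfolding collinear_3_eq_affine_dependent by auto
qed

text \<open>The order of the two remaining vertices is free, so the counterclockwise one can be
  taken. The sign conventions below rest on this choice.\<close>

lemma two_simplex_at_vertex:
  assumes "2 simplex K" "p extreme_point_of K"
  shows "\<exists>b c. orient p b c > 0 \<and> K = convex hull {p,b,c}"
proof -
  obtain C where C: "\<not> affine_dependent C" "card C = 3" "K = convex hull C"
    using assms(1) unfolding simplex_def by auto
  then have "p \<in> C" using assms(2) extreme_point_of_convex_hull_affine_independent by blast
  then have "card (C - {p}) = 2" using C(2) by (simp add: card_Diff_singleton_if)
  then obtain b c where bc: "C - {p} = {b,c}" "b \<noteq> c" by (meson card_2_iff)
  then have C': "C = {p,b,c}" "p \<noteq> b" "p \<noteq> c" using \<open>p \<in> C\<close> by auto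
  then have "orient p b c \<noteq> 0"
    using C(1) bc(2) unfolding orient_eq_0_collinear collinear_3_eq_affine_dependent by auto
  then consider "orient p b c > 0" | "orient p c b > 0"
    using orient_swap[of p b c] by linarith
  then show ?thesis
  proof cases
    case 1
    then show ?thesis using C(3) C'(1) by blast
  next
    case 2
    moreover have "K = convex hull {p,c,b}"
      unfolding C(3) C'(1) by (intro arg_cong[where f="\<lambda>S. convex hull S"]) auto
    ultimately show ?thesis by blast
  qed
qed

lemma two_simplexE:
  assumes "2 simplex K"
  obtains a b c where "orient a b c > 0" "K = convex hull {a,b,c}"
proof -
  obtain C where C: "\<not> affine_dependent C" "card C = 3" "K = convex hull C"
    using assms(1) unfolding simplex_def by auto
  then obtain p where "p \<in> C" by fastforce
  then have "p extreme_point_of K" using C extreme_point_of_convex_hull_affine_independent by blast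
  then show ?thesis using two_simplex_at_vertex[OF assms] that by blast
qed

lemma vertices_of_triangle:
  assumes "orient a b c > 0"
  shows "{p. p extreme_point_of (convex hull {a,b,c})} = {a,b,c}"
  using extreme_point_of_convex_hull_affine_independent[OF orient_nondegenerate(4)[OF assms]]
  by auto

lemma edge_of_triangle_iff:
  assumes "orient a b c > 0"
  shows "e edge_of (convex hull {a,b,c}) \<longleftrightarrow>
    e = closed_segment a b \<or> e = closed_segment b c \<or> e = closed_segment c a"
proof
  note nd = orient_nondegenerate[OF assms]
  assume "e edge_of (convex hull {a,b,c})"
  then obtain d where d: "d \<subseteq> {a,b,c}" "e = convex hull d" "aff_dim e = 1"
    unfolding edge_of_def face_of_convex_hull_affine_independent[OF nd(4)] by auto
  have "\<not> affine_dependent d" using d nd(4) affine_dependent_subset by blast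
  then have "card d = 2" using d(2,3) aff_dim_affine_independent[of d]
    by (simp add: aff_dim_convex_hull)
  then obtain x y where xy: "d = {x,y}" "x \<noteq> y" by (meson card_2_iff)
  then have e: "e = closed_segment x y" using d(2) by (simp add: segment_convex_hull)
  have "x \<in> {a,b,c}" "y \<in> {a,b,c}" using d(1) xy(1) by auto
  then show "e = closed_segment a b \<or> e = closed_segment b c \<or> e = closed_segment c a"
    using xy(2) unfolding e closed_segment_eq doubleton_eq_iff by blast
next
  note nd = orient_nondegenerate[OF assms]
  have "closed_segment x y edge_of (convex hull {a,b,c})" if "x \<noteq> y" "{x,y} \<subseteq> {a,b,c}" for x y
  proof -
    have "closed_segment x y face_of (convex hull {a,b,c})"
      unfolding face_of_convex_hull_affine_independent[OF nd(4)]
      using that(2) segment_convex_hull[of x y] by blast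
    moreover have "aff_dim (closed_segment x y) = 1"
      using that(1) by (simp add: segment_convex_hull aff_dim_convex_hull aff_dim_2)
    ultimately show ?thesis unfolding edge_of_def by blast
  qed
  then show "e edge_of (convex hull {a,b,c})"
    if "e = closed_segment a b \<or> e = closed_segment b c \<or> e = closed_segment c a"
    using that nd(1-3) by blast
qed

text \<open>In counterclockwise order the triangle lies to the left of the edge. The outward normal
  is therefore the edge direction turned clockwise by ninety degrees, and \<open>- Jmat\<close>
  turns it back.\<close>

lemma tangent_triangle:
  assumes D: "orient a b c > 0"
  shows "tangent (convex hull {a,b,c}) (closed_segment a b) = sgn (b - a)"
proof -
  let ?K = "convex hull {a,b,c}" and ?l = "norm (b - a)"
  define m :: plane where "m = vector [(b - a)$2 / ?l, - (b - a)$1 / ?l]"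
  have ab: "?l > 0" using orient_nondegenerate(1)[OF D] by simp
  have l2: "((b - a)$1)^2 + ((b - a)$2)^2 = ?l^2"
    unfolding power2_norm_eq_inner inner_plane by (simp add: power2_eq_square)
  have mz: "m \<bullet> (z - x) = - (orient a b z - orient a b x) / ?l" for z x
  proof -
    have "m \<bullet> (z - x) = ((b - a)$2 * (z - x)$1 - (b - a)$1 * (z - x)$2) / ?l"
      by (simp add: m_def inner_plane vector_2 diff_divide_distrib del: vector_minus_component)
    also have "\<dots> = - (orient a b z - orient a b x) / ?l"
      by (rule arg_cong[where f="\<lambda>t. t / ?l"]) (simp add: orient_simps algebra_simps)
    finally show ?thesis .
  qed
  have on_e: "orient a b x = 0" if "x \<in> closed_segment a b" for x
  proof -
    obtain s where x: "x = (1 - s) *\<^sub>R a + s *\<^sub>R b" using \<open>x \<in> _\<close> unfolding in_segment by blast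
    show ?thesis unfolding x by (simp add: orient_simps algebra_simps)
  qed
  have nm: "norm m = 1"
  proof -
    have "m \<bullet> m = (((b - a)$1)\<^sup>2 + ((b - a)$2)\<^sup>2) / ?l\<^sup>2"
      by (simp add: inner_plane m_def vector_2 power2_eq_square add_divide_distrib
          del: vector_minus_component)
    then show ?thesis using ab unfolding l2 norm_eq_1 by simp
  qed
  have "outer_normal ?K (closed_segment a b) = m"
    unfolding outer_normal_def
  proof (rule the_equality)
    show "norm m = 1 \<and> (\<forall>x\<in>closed_segment a b. \<forall>z\<in>?K. m \<bullet> (z - x) \<le> 0)"
      using nm ab on_e mem_triangle_iff[OF D] by (auto simp: mz)
  next
    fix n assume n: "norm n = 1 \<and> (\<forall>x\<in>closed_segment a b. \<forall>z\<in>?K. n \<bullet> (z - x) \<le> 0)"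
    have K: "a \<in> ?K" "b \<in> ?K" "c \<in> ?K" by (auto intro: hull_inc)
    have e: "a \<in> closed_segment a b" "b \<in> closed_segment a b" by auto
    \<comment> \<open>Both endpoints may serve as base point, which forces orthogonality to the
      edge; the third vertex \<open>c\<close> then selects the sign.\<close>
    have 1: "n \<bullet> (b - a) \<le> 0" "n \<bullet> (a - b) \<le> 0" "n \<bullet> (c - a) \<le> 0" using n K e by auto
    then have perp: "n \<bullet> (b - a) = 0" by (simp add: inner_diff_right)
    define k where "k = n \<bullet> m"
    have "cross2 m n = (n \<bullet> (b - a)) / ?l"
      by (simp add: cross2_def m_def inner_plane vector_2 add_divide_distrib mult.commute
          del: vector_minus_component)
    then have "n = k *\<^sub>R m"
      using cross2_decompose[of m n] nm perp by (simp add: k_def norm_eq_1)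
    moreover have "\<bar>k\<bar> = 1" using n nm \<open>n = k *\<^sub>R m\<close> by simp
    moreover have "k \<ge> 0"
    proof -
      have "k * (m \<bullet> (c - a)) \<le> 0" using 1(3) \<open>n = k *\<^sub>R m\<close> by simp
      moreover have "m \<bullet> (c - a) < 0" using D ab on_e[of a] by (simp add: mz)
      ultimately show ?thesis by (simp add: mult_le_0_iff)
    qed
    ultimately show "n = m" by simp
  qed
  then show ?thesis
    by (simp add: tangent_def plane_eq_iff m_def Jmat_def matrix_vector_mult_def sum_2 vector_2
        sgn_div_norm divide_inverse mult.commute del: vector_minus_component)
qed

text \<open>At the midpoint of the edge the inequalities of the other two sides are strict, and they
  remain so in a small ball.\<close>

lemma halfball_subset_triangle:
  assumes D: "orient a b c > 0"
  shows "\<exists>d>0. \<forall>x\<in>ball (midpoint a b) d. orient a b x \<ge> 0 \<longrightarrow> x \<in> convex hull {a,b,c}"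
proof -
  let ?m = "midpoint a b"
  have "orient ?m b c = orient a b c / 2" "orient a ?m c = orient a b c / 2"
    by (simp_all add: orient_simps midpoint_def field_simps)
  then have m: "orient ?m b c > 0" "orient a ?m c > 0" using D by simp_all
  have "open {x. orient x b c > 0 \<and> orient a x c > 0}"
    unfolding orient_simps by (intro open_Collect_conj open_Collect_less continuous_intros)
  then obtain d where "d > 0" "ball ?m d \<subseteq> {x. orient x b c > 0 \<and> orient a x c > 0}"
    using m open_contains_ball by blast
  then show ?thesis using mem_triangle_iff[OF D] by (force intro: less_imp_le)
qed


section \<open>Areas of sectors\<close>

text \<open>The first coordinate is half of the squared radius, which makes the Jacobian equal to 1.\<close>

definition polar :: "plane \<Rightarrow> plane" where
  "polar z = vector [sqrt (2 * z$1) * cos (z$2), sqrt (2 * z$1) * sin (z$2)]"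

definition polar' :: "plane \<Rightarrow> plane \<Rightarrow> plane" where
  "polar' z h = vector [cos (z$2) / sqrt (2 * z$1) * h$1 - sqrt (2 * z$1) * sin (z$2) * h$2,
     sin (z$2) / sqrt (2 * z$1) * h$1 + sqrt (2 * z$1) * cos (z$2) * h$2]"

lemma has_derivative_polar:
  assumes "z$1 > 0"
  shows "(polar has_derivative polar' z) (at z within S)"
proof -
  have nth: "((\<lambda>x::plane. x $ i) has_derivative (\<lambda>h. h $ i)) (at z within S)" for i
    by (rule bounded_linear_imp_has_derivative[OF bounded_linear_vec_nth])
  have 1: "((\<lambda>x. polar x $ 1) has_derivative (\<lambda>h. polar' z h $ 1)) (at z within S)"
    unfolding polar_def polar'_def vector_2
    by (rule nth derivative_eq_intros refl | use assms in \<open>force simp: field_simps\<close>)+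
  have 2: "((\<lambda>x. polar x $ 2) has_derivative (\<lambda>h. polar' z h $ 2)) (at z within S)"
    unfolding polar_def polar'_def vector_2
    by (rule nth derivative_eq_intros refl | use assms in \<open>force simp: field_simps\<close>)+
  show ?thesis
    unfolding has_derivative_componentwise_within[of polar]
    using 1 2 by (auto simp: Basis_vec_def inner_axis axis_eq_axis forall_2)
qed

lemma det_polar':
  assumes "z$1 > 0"
  shows "det (matrix (polar' z)) = 1"
proof -
  have s: "sqrt (2 * z$1) > 0" using assms by simp
  have "det (matrix (polar' z)) = (cos (z$2))\<^sup>2 + (sin (z$2))\<^sup>2"
    using s by (simp add: det_2 matrix_def polar'_def axis_def vector_2 power2_eq_square)
  then show ?thesis by simp
qed

lemma inj_on_polar:
  "inj_on polar {z. 0 < z$1 \<and> \<alpha> < z$2 \<and> z$2 < \<alpha> + 2 * pi}"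
proof (rule inj_onI)
  fix z w assume z: "z \<in> {z. 0 < z$1 \<and> \<alpha> < z$2 \<and> z$2 < \<alpha> + 2 * pi}"
    and w: "w \<in> {z. 0 < z$1 \<and> \<alpha> < z$2 \<and> z$2 < \<alpha> + 2 * pi}" and eq: "polar z = polar w"
  have n: "(polar x $ 1)\<^sup>2 + (polar x $ 2)\<^sup>2 = 2 * x$1" if "x$1 > 0" for x
  proof -
    have "(polar x $ 1)\<^sup>2 + (polar x $ 2)\<^sup>2 = 2 * x$1 * ((cos (x$2))\<^sup>2 + (sin (x$2))\<^sup>2)"
      using that by (simp add: polar_def vector_2 power_mult_distrib distrib_left
          del: sin_cos_squared_add sin_cos_squared_add2)
    then show ?thesis unfolding sin_cos_squared_add2 by simp
  qed
  have 1: "z$1 = w$1" using n[of z] n[of w] z w eq by simp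
  then have "cos (z$2) = cos (w$2)" "sin (z$2) = sin (w$2)"
    using eq z w by (auto simp: polar_def plane_eq_iff vector_2)
  then obtain n :: int where n: "z$2 = w$2 + 2 * pi * n"
    using sin_cos_eq_iff[of "z$2" "w$2"] by auto
  then have "\<bar>2 * pi * n\<bar> < 2 * pi * 1" using z w by auto
  then have "n = 0" by (simp add: abs_mult)
  then show "z = w" using 1 n by (simp add: plane_eq_iff)
qed


text \<open>By Lagrange's identity the inner and the cross product, divided by the product of the
  norms, are a cosine and a sine. The positive cross product makes the sine positive, so that
  \<open>arccos\<close> gives the counterclockwise angle from \<open>u\<close> to
  \<open>w\<close>.\<close>

lemma polar_coordinates_relative:
  assumes u: "u = norm u *\<^sub>R vector [cos \<alpha>, sin \<alpha>]" and D: "cross2 u w > 0"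
  defines "\<theta> \<equiv> arccos (u \<bullet> w / (norm u * norm w))"
  shows "0 < \<theta>" "\<theta> < pi" "w = norm w *\<^sub>R vector [cos (\<alpha> + \<theta>), sin (\<alpha> + \<theta>)]"
proof -
  have "u \<noteq> 0" "w \<noteq> 0" using D by (auto simp: cross2_def)
  then have pos: "norm u > 0" "norm w > 0" by auto
  let ?c = "u \<bullet> w / (norm u * norm w)" and ?s = "cross2 u w / (norm u * norm w)"
  have "(u \<bullet> w)\<^sup>2 + (cross2 u w)\<^sup>2 = (u \<bullet> u) * (w \<bullet> w)"
    by (simp add: inner_plane cross2_def power2_eq_square algebra_simps)
  also have "\<dots> = (norm u * norm w)\<^sup>2"
    by (simp add: power_mult_distrib power2_norm_eq_inner)
  finally have "?c\<^sup>2 + ?s\<^sup>2 = 1"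
    using pos by (simp add: power_divide add_divide_distrib[symmetric])
  moreover have spos: "?s > 0" using D pos by simp
  ultimately have c2: "?c\<^sup>2 < 1" and s: "?s = sqrt (1 - ?c\<^sup>2)"
    by (smt (verit) zero_less_power2) (smt (verit) \<open>?c\<^sup>2 + ?s\<^sup>2 = 1\<close> spos real_sqrt_unique)
  then have c: "-1 < ?c" "?c < 1"
    unfolding abs_square_less_1 by linarith+
  then show "0 < \<theta>" "\<theta> < pi"
    unfolding \<theta>_def using arccos_lt_bounded by auto
  have cos: "cos \<theta> = ?c" and sin: "sin \<theta> = ?s"
    unfolding \<theta>_def s using c by (auto simp: cos_arccos sin_arccos)
  have uc: "u$1 = norm u * cos \<alpha>" "u$2 = norm u * sin \<alpha>"
    by (subst u, simp add: vector_2)+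
  have "(norm u)\<^sup>2 *\<^sub>R w = (u \<bullet> w) *\<^sub>R u + cross2 u w *\<^sub>R vector [- u$2, u$1]"
    using cross2_decompose[of u w] by (simp add: power2_norm_eq_inner inner_commute)
  also have "u \<bullet> w = norm u * norm w * cos \<theta>" using cos pos by simp
  also have "cross2 u w = norm u * norm w * sin \<theta>" using sin pos by simp
  finally have "(norm u)\<^sup>2 * w$1 = (norm u)\<^sup>2 * (norm w * cos (\<alpha> + \<theta>))"
    "(norm u)\<^sup>2 * w$2 = (norm u)\<^sup>2 * (norm w * sin (\<alpha> + \<theta>))"
    unfolding plane_eq_iff
    by (simp_all add: vector_2 uc cos_add sin_add power2_eq_square algebra_simps)
  moreover have "(norm u)\<^sup>2 \<noteq> 0" using pos by simp
  ultimately have "w$1 = norm w * cos (\<alpha> + \<theta>)" "w$2 = norm w * sin (\<alpha> + \<theta>)"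
    unfolding mult_cancel_left by blast+
  then show "w = norm w *\<^sub>R vector [cos (\<alpha> + \<theta>), sin (\<alpha> + \<theta>)]"
    unfolding plane_eq_iff vector_scaleR_component vector_2 real_scaleR_def by blast
qed

lemma polar_coordinates:
  fixes u :: plane
  obtains \<alpha> where "u = norm u *\<^sub>R vector [cos \<alpha>, sin \<alpha>]"
proof (cases "u = 0")
  case False
  have "(u$1 / norm u)\<^sup>2 + (u$2 / norm u)\<^sup>2 = (u \<bullet> u) / (norm u)\<^sup>2"
    by (simp add: power_divide inner_plane power2_eq_square add_divide_distrib)
  also have "\<dots> = 1" using False by (simp add: power2_norm_eq_inner)
  finally obtain \<alpha> where "u$1 / norm u = cos \<alpha>" "u$2 / norm u = sin \<alpha>"
    by (rule sincos_total_2pi)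
  then have "u$1 = norm u * cos \<alpha>" "u$2 = norm u * sin \<alpha>"
    using False by (metis nonzero_mult_div_cancel_left norm_eq_zero times_divide_eq_right)+
  then have "u = norm u *\<^sub>R vector [cos \<alpha>, sin \<alpha>]"
    unfolding plane_eq_iff vector_scaleR_component vector_2 real_scaleR_def by blast
  then show ?thesis by (rule that)
next
  case True
  show ?thesis by (rule that[of 0]) (simp add: True)
qed

lemma cross2_polar:
  assumes "u = r *\<^sub>R vector [cos \<alpha>, sin \<alpha>]" "x = s *\<^sub>R vector [cos \<beta>, sin \<beta>]"
  shows "cross2 u x = r * s * sin (\<beta> - \<alpha>)"
  unfolding assms by (simp add: cross2_def vector_2 sin_diff algebra_simps)

lemma polar_image_sector:
  assumes u: "u = norm u *\<^sub>R vector [cos \<alpha>, sin \<alpha>]" and D: "cross2 u w > 0" and R: "R > 0"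
  defines "\<theta> \<equiv> arccos (u \<bullet> w / (norm u * norm w))"
  shows "polar ` box (vector [0, \<alpha>]) (vector [R\<^sup>2 / 2, \<alpha> + \<theta>]) =
    {x. cross2 u x > 0 \<and> cross2 x w > 0 \<and> norm x < R}"
proof (intro set_eqI iffI)
  have pos: "norm u > 0" "norm w > 0" using D by (auto simp: cross2_def)
  note w = polar_coordinates_relative[OF u D, folded \<theta>_def]
  {
    fix x assume "x \<in> polar ` box (vector [0, \<alpha>]) (vector [R\<^sup>2 / 2, \<alpha> + \<theta>])"
    then obtain z where z: "x = polar z" "0 < z$1" "z$1 < R\<^sup>2 / 2" "\<alpha> < z$2" "z$2 < \<alpha> + \<theta>"
      by (auto simp: mem_box_cart forall_2 vector_2)
    have x: "x = sqrt (2 * z$1) *\<^sub>R vector [cos (z$2), sin (z$2)]"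
      by (simp add: z(1) polar_def plane_eq_iff vector_2)
    have s: "sqrt (2 * z$1) > 0" using z by simp
    have "cross2 u x > 0"
      unfolding cross2_polar[OF u x] using z w pos s by (intro mult_pos_pos sin_gt_zero) auto
    moreover have "cross2 x w > 0"
      unfolding cross2_polar[OF x w(3)] using z w pos s by (intro mult_pos_pos sin_gt_zero) auto
    moreover have "(norm x)\<^sup>2 < R\<^sup>2"
    proof -
      have "(norm x)\<^sup>2 = 2 * z$1 * ((cos (z$2))\<^sup>2 + (sin (z$2))\<^sup>2)"
        unfolding power2_norm_eq_inner inner_plane x using z(2)
        by (simp add: vector_2 power2_eq_square[symmetric] power_mult_distrib distrib_left
          del: sin_cos_squared_add sin_cos_squared_add2)
      then show ?thesis using z(3) unfolding sin_cos_squared_add2 by simp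
    qed
    ultimately show "x \<in> {x. cross2 u x > 0 \<and> cross2 x w > 0 \<and> norm x < R}"
      using R by (simp add: power_less_imp_less_base)
  next
    fix x assume "x \<in> {x. cross2 u x > 0 \<and> cross2 x w > 0 \<and> norm x < R}"
    then have x: "cross2 u x > 0" "cross2 x w > 0" "norm x < R" by auto
    define \<beta> where "\<beta> = arccos (u \<bullet> x / (norm u * norm x))"
    note b = polar_coordinates_relative[OF u x(1), folded \<beta>_def]
    have nx: "norm x > 0" using x by (auto simp: cross2_def)
    have "norm x * norm w * sin (\<alpha> + \<theta> - (\<alpha> + \<beta>)) > 0"
      using x(2) unfolding cross2_polar[OF b(3) w(3)] .
    moreover have "\<alpha> + \<theta> - (\<alpha> + \<beta>) = \<theta> - \<beta>" by simp
    ultimately have "norm x * norm w * sin (\<theta> - \<beta>) > 0" by metis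
    then have "sin (\<theta> - \<beta>) > 0"
      by (rule zero_less_mult_pos[OF _ mult_pos_pos[OF nx pos(2)]])
    \<comment> \<open>Both angles lie strictly between 0 and \<open>pi\<close>; for
      \<open>\<beta> \<ge> \<theta>\<close> the sine of \<open>\<theta> - \<beta>\<close> would not
      be positive.\<close>
    then have "\<beta> < \<theta>"
      using sin_ge_zero[of "\<beta> - \<theta>"] b w sin_minus[of "\<theta> - \<beta>"] by (smt (verit))
    moreover have "(norm x)\<^sup>2 < R\<^sup>2" using x(3) by (simp add: power_strict_mono)
    ultimately have "(vector [(norm x)\<^sup>2 / 2, \<alpha> + \<beta>] :: plane) \<in> box (vector [0, \<alpha>]) (vector [R\<^sup>2 / 2, \<alpha> + \<theta>])"
      using nx b(1,2) by (simp add: mem_box_cart forall_2 vector_2)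
    moreover have "polar (vector [(norm x)\<^sup>2 / 2, \<alpha> + \<beta>]) = x"
    proof -
      have "polar (vector [(norm x)\<^sup>2 / 2, \<alpha> + \<beta>]) = norm x *\<^sub>R vector [cos (\<alpha> + \<beta>), sin (\<alpha> + \<beta>)]"
        by (simp add: polar_def plane_eq_iff vector_2)
      then show ?thesis using b(3) by simp
    qed
    ultimately show "x \<in> polar ` box (vector [0, \<alpha>]) (vector [R\<^sup>2 / 2, \<alpha> + \<theta>])"
      by (metis image_eqI)
  }
qed

text \<open>\<open>polar\<close> maps a box injectively onto the sector with Jacobian 1, so the area
  is that of the box, whose sides are \<open>R\<^sup>2 / 2\<close> and
  \<open>\<theta>\<close>.\<close>

lemma measure_sector:
  assumes D: "cross2 u w > 0" and R: "R > 0"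
  defines "\<theta> \<equiv> arccos (u \<bullet> w / (norm u * norm w))"
  shows "measure lebesgue {x. cross2 u x > 0 \<and> cross2 x w > 0 \<and> norm x < R} = R\<^sup>2 / 2 * \<theta>"
proof -
  obtain \<alpha> where u: "u = norm u *\<^sub>R vector [cos \<alpha>, sin \<alpha>]" by (rule polar_coordinates)
  note w = polar_coordinates_relative[OF u D, folded \<theta>_def]
  let ?a = "vector [0, \<alpha>] :: plane" and ?b = "vector [R\<^sup>2 / 2, \<alpha> + \<theta>] :: plane"
  let ?B = "box ?a ?b"
  have B: "0 < z$1" if "z \<in> ?B" for z using that by (auto simp: mem_box_cart forall_2 vector_2)
  have "inj_on polar ?B"
    by (rule inj_on_subset[OF inj_on_polar[of \<alpha>]]) (use w in \<open>auto simp: mem_box_cart forall_2 vector_2\<close>)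
  moreover have det: "\<bar>det (matrix (polar' z))\<bar> = 1" if "z \<in> ?B" for z
    using det_polar' B[OF that] by simp
  moreover have "(\<lambda>z. \<bar>det (matrix (polar' z))\<bar>) integrable_on ?B"
    by (rule integrable_eq[of "\<lambda>z. 1"]) (auto simp: det intro!: integrable_on_const)
  ultimately have "measure lebesgue (polar ` ?B) = integral ?B (\<lambda>z. \<bar>det (matrix (polar' z))\<bar>)"
    using B has_derivative_polar by (intro measure_differentiable_image_eq) auto
  also have "\<dots> = integral ?B (\<lambda>z. 1)"
    by (rule integral_cong) (simp add: det)
  also have "\<dots> = measure lebesgue ?B" using lmeasure_integral[of ?B] by simp
  also have "\<dots> = measure lborel (cbox ?a ?b)"
    by (simp add: measure_lborel_box_eq measure_lborel_cbox_eq)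
  also have "\<dots> = R\<^sup>2 / 2 * \<theta>"
    using w R by (subst content_cbox_cart) (auto simp: UNIV_2 vector_2 interval_ne_empty_cart forall_2)
  finally show ?thesis unfolding polar_image_sector[OF u D R, folded \<theta>_def] .
qed


text \<open>Close to \<open>p\<close> the opposite side imposes no condition, so the triangle agrees
  with its cone at \<open>p\<close>. Up to parts of the two bounding lines this is a translated open
  sector.\<close>

lemma measure_triangle_Int_ball:
  assumes D: "orient p b c > 0"
  defines "\<theta> \<equiv> arccos ((b - p) \<bullet> (c - p) / (norm (b - p) * norm (c - p)))"
  shows "\<exists>d>0. \<forall>r. 0 < r \<and> r \<le> d \<longrightarrow>
    measure lebesgue (convex hull {p,b,c} \<inter> ball p r) = r\<^sup>2 / 2 * \<theta>"
proof -
  let ?u = "b - p" and ?w = "c - p"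
  have "open {x. orient x b c > 0}"
    unfolding orient_simps by (intro open_Collect_less continuous_intros)
  then obtain d where d: "d > 0" "ball p d \<subseteq> {x. orient x b c > 0}"
    using D open_contains_ball by blast
  have "measure lebesgue (convex hull {p,b,c} \<inter> ball p r) = r\<^sup>2 / 2 * \<theta>" if r: "0 < r" "r \<le> d" for r
  proof -
    define S where "S = {x. cross2 ?u x > 0 \<and> cross2 x ?w > 0 \<and> norm x < r}"
    let ?T = "convex hull {p,b,c} \<inter> ball p r"
    have S: "(+) p ` S = {x. orient p b x > 0 \<and> orient p x c > 0 \<and> dist p x < r}"
    proof (intro set_eqI iffI)
      fix x assume "x \<in> {x. orient p b x > 0 \<and> orient p x c > 0 \<and> dist p x < r}"
      then have "x - p \<in> S" by (auto simp: S_def orient_def dist_norm norm_minus_commute)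
      then show "x \<in> (+) p ` S" by (intro image_eqI[of _ _ "x - p"]) auto
    qed (auto simp: S_def orient_def dist_norm)
    have "open ((+) p ` S)"
      unfolding S orient_simps by (intro open_Collect_conj open_Collect_less continuous_intros)
    moreover have "bounded ((+) p ` S)"
      by (rule bounded_subset[of "ball p r"]) (auto simp: S)
    ultimately have lm: "(+) p ` S \<in> lmeasurable"
      by (rule lmeasurable_open[rotated])
    have line: "negligible {x. orient p q x = 0}" if "q \<noteq> p" for q
    proof -
      have "{x. orient p q x = 0} =
        {x. vector [- (q - p)$2, (q - p)$1] \<bullet> x = vector [- (q - p)$2, (q - p)$1] \<bullet> p}"
        by (auto simp: orient_simps inner_plane vector_2 algebra_simps)
      moreover have "vector [- (q - p)$2, (q - p)$1] \<noteq> (0 :: plane)"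
        using that by (auto simp: plane_eq_iff vector_2)
      ultimately show ?thesis using negligible_hyperplane by metis
    qed
    have "negligible ((+) p ` S - ?T \<union> (?T - (+) p ` S))"
    proof (rule negligible_subset)
      show "negligible ({x. orient p b x = 0} \<union> {x. orient p c x = 0})"
        using orient_nondegenerate[OF D] by (intro negligible_Un line) auto
      have "x \<in> convex hull {p,b,c} \<longleftrightarrow> orient p b x \<ge> 0 \<and> orient p x c \<ge> 0" if "x \<in> ball p r" for x
      proof -
        have "x \<in> ball p d" using that r by auto
        then have "orient x b c > 0" using d(2) by blast
        then show ?thesis using mem_triangle_iff[OF D, of x] by auto
      qed
      then show "(+) p ` S - ?T \<union> (?T - (+) p ` S) \<subseteq> {x. orient p b x = 0} \<union> {x. orient p c x = 0}"
        using orient_swap[of p c] unfolding S by force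
    qed
    then have "measure lebesgue ?T = measure lebesgue ((+) p ` S)"
      by (rule measure_negligible_symdiff[OF lm])
    also have "\<dots> = measure lebesgue S" by (rule measure_translation)
    also have "\<dots> = r\<^sup>2 / 2 * \<theta>"
      unfolding S_def \<theta>_def by (rule measure_sector) (use D r in \<open>auto simp: orient_def\<close>)
    finally show ?thesis .
  qed
  then show ?thesis using d(1) by blast
qed


section \<open>Triangulations\<close>

lemma two_simplex_at_edge:
  assumes "2 simplex K" "e edge_of K"
  obtains a b c where "orient a b c > 0" "K = convex hull {a,b,c}" "e = closed_segment a b"
proof -
  obtain a b c where D: "orient a b c > 0" and K: "K = convex hull {a,b,c}"
    using two_simplexE[OF assms(1)] by blast
  have "{b,c,a} = {a,b,c}" "{c,a,b} = {a,b,c}" by auto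
  then have "K = convex hull {b,c,a}" "K = convex hull {c,a,b}" using K by simp_all
  moreover have "orient b c a > 0" "orient c a b > 0"
    using D orient_cycle by metis+
  ultimately show ?thesis
    using that D K assms(2) unfolding K edge_of_triangle_iff[OF D] by blast
qed

lemma two_simplex_interior:
  assumes "2 simplex (K :: plane set)"
  shows "interior K \<noteq> {}" "closure (interior K) = K" "negligible (K - interior K)"
proof -
  have K: "convex K" "closed K" "K \<noteq> {}" "aff_dim K = 2"
    using assms convex_simplex closed_simplex aff_dim_simplex by (blast, blast, force, blast)
  then have "rel_interior K = interior K" by (intro interior_rel_interior) simp
  then show ne: "interior K \<noteq> {}" using K rel_interior_eq_empty by metis
  then show "closure (interior K) = K"
    using K by (simp add: convex_closure_interior)
  have "K - interior K \<subseteq> frontier K" using K by (simp add: frontier_def)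
  then show "negligible (K - interior K)"
    using K negligible_convex_frontier negligible_subset by blast
qed

text \<open>The extreme points determine the vertices only as a set, so \<open>u\<close> and
  \<open>w\<close> are fixed up to exchange; the symmetry of \<open>A\<close> makes the formula
  invariant under it.\<close>

lemma angle_at_triangle:
  assumes D: "orient p b c > 0" and A: "transpose A = A"
  shows "angle_at A (convex hull {p,b,c}) p = arccos ((b - p) \<bullet> (A *v (c - p)) /
    (sqrt ((b - p) \<bullet> (A *v (b - p))) * sqrt ((c - p) \<bullet> (A *v (c - p)))))" (is "_ = ?f (b - p) (c - p)")
proof -
  have sym: "x \<bullet> (A *v y) = y \<bullet> (A *v x)" for x y
    using dot_lmul_matrix[of x A y] A by (metis inner_commute transpose_matrix_vector)
  have swap: "?f x y = ?f y x" for x y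
    by (simp add: sym[of x y] mult.commute)
  show ?thesis unfolding angle_at_def
  proof (rule the_equality)
    show "\<exists>u w. convex hull {p,b,c} = convex hull {p, p + u, p + w} \<and> ?f (b - p) (c - p) = ?f u w"
      by (intro exI[of _ "b - p"] exI[of _ "c - p"]) simp
  next
    fix \<theta> assume "\<exists>u w. convex hull {p,b,c} = convex hull {p, p + u, p + w} \<and> \<theta> = ?f u w"
    then obtain u w where uw: "convex hull {p,b,c} = convex hull {p, p + u, p + w}" "\<theta> = ?f u w"
      by blast
    have "{x. x extreme_point_of (convex hull {p, p + u, p + w})} = {p,b,c}"
      using vertices_of_triangle[OF D] uw(1) by simp
    then have "{p,b,c} \<subseteq> {p, p + u, p + w}"
      using extreme_point_of_convex_hull by blast
    then have "b = p + u \<and> c = p + w \<or> b = p + w \<and> c = p + u"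
      using orient_nondegenerate[OF D] by auto
    then have "b - p = u \<and> c - p = w \<or> b - p = w \<and> c - p = u" by auto
    then show "\<theta> = ?f (b - p) (c - p)" using uw(2) swap by metis
  qed
qed

locale triangulated_domain =
  fixes \<Omega> :: "plane set" and T :: "plane set set"
  assumes domain: "polygonal_domain \<Omega>" and triangulates: "triangulates T \<Omega>"
begin

lemma open_domain: "open \<Omega>" and interior_closure_domain: "interior (closure \<Omega>) = \<Omega>"
  using domain unfolding polygonal_domain_def by auto

lemma finite_T: "finite T" and simplexT: "K \<in> T \<Longrightarrow> 2 simplex K" and UnionT: "\<Union>T = closure \<Omega>"
  and face_Int: "K \<in> T \<Longrightarrow> K' \<in> T \<Longrightarrow> (K \<inter> K') face_of K"
  using triangulates unfolding triangulates_def triangulation_def by auto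

lemma closed_cell: "K \<in> T \<Longrightarrow> closed K"
  and compact_cell: "K \<in> T \<Longrightarrow> compact K"
  using simplexT closed_simplex compact_simplex by blast+

lemma interior_cell_subset: "K \<in> T \<Longrightarrow> interior K \<subseteq> \<Omega>"
  using UnionT interior_closure_domain by (metis Union_upper interior_mono)

text \<open>Two different triangles cannot both equal their intersection. It is thus a proper face
  of one of them and lies in its boundary.\<close>

lemma negligible_Int_cells:
  assumes "K \<in> T" "K' \<in> T" "K \<noteq> K'"
  shows "negligible (K \<inter> K')"
proof -
  have "K \<inter> K' \<noteq> K \<or> K' \<inter> K \<noteq> K'" using assms by blast
  then obtain F G where F: "F \<in> T" "G \<in> T" "F \<inter> G = K \<inter> K'" "F \<inter> G \<noteq> F"
    using assms by (metis Int_commute)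
  then have "F \<inter> G \<subseteq> F - interior F"
    using face_of_disjoint_interior[OF face_Int[of F G]] by blast
  then show ?thesis
    using two_simplex_interior(3)[OF simplexT] F negligible_subset by metis
qed

lemma negligible_domain_minus_interiors: "negligible (\<Omega> - (\<Union>K\<in>T. interior K))"
proof (rule negligible_subset)
  show "negligible (\<Union>K\<in>T. K - interior K)"
    using finite_T two_simplex_interior(3)[OF simplexT] by (intro negligible_Union) auto
  show "\<Omega> - (\<Union>K\<in>T. interior K) \<subseteq> (\<Union>K\<in>T. K - interior K)"
    using UnionT closure_subset[of \<Omega>] by blast
qed

text \<open>There are no hanging vertices: extremality passes from one triangle to the common face
  and from there to the other triangle.\<close>

lemma extreme_point_of_cell:
  assumes "y \<in> vertices T" "K \<in> T" "y \<in> K"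
  shows "y extreme_point_of K"
proof -
  obtain K' where K': "K' \<in> T" "y extreme_point_of K'" using assms unfolding vertices_def by blast
  then have "y \<in> K'" by (simp add: extreme_point_of_def)
  then have "y extreme_point_of (K' \<inter> K)"
    using extreme_point_of_face[OF face_Int[OF K'(1) assms(2)]] K' assms by blast
  then show ?thesis
    using extreme_point_of_face[OF face_Int[OF assms(2) K'(1)]] by (simp add: Int_commute)
qed

lemma sum_euclidean_angles:
  assumes y: "y \<in> vertices T" "y \<notin> frontier \<Omega>"
  shows "(\<Sum>K | K \<in> T \<and> y extreme_point_of K. angle_at (mat 1) K y) = 2 * pi"
proof -
  let ?W = "{K \<in> T. y extreme_point_of K}"
  have finW: "finite ?W" using finite_T by simp
  have "y \<in> closure \<Omega>"
    using y(1) UnionT unfolding vertices_def extreme_point_of_def by blast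
  then have y\<Omega>: "y \<in> \<Omega>" using y(2) open_domain by (simp add: frontier_def interior_open)
  \<comment> \<open>Away from the finitely many closed triangles that miss \<open>y\<close>, a small
    disc around \<open>y\<close> meets only triangles having \<open>y\<close> as a vertex.\<close>
  have "open (\<Omega> - \<Union>{K \<in> T. y \<notin> K})"
    using open_domain finite_T closed_cell by (intro open_Diff closed_Union) auto
  then obtain d0 where d0: "d0 > 0" "ball y d0 \<subseteq> \<Omega> - \<Union>{K \<in> T. y \<notin> K}"
    using y\<Omega> open_contains_ball by blast
  have ex: "\<exists>d>0. \<forall>r. 0 < r \<and> r \<le> d \<longrightarrow> measure lebesgue (K \<inter> ball y r) = r\<^sup>2 / 2 * angle_at (mat 1) K y"
    if W: "K \<in> ?W" for K
  proof -
    obtain b c where "orient y b c > 0" "K = convex hull {y,b,c}"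
      using two_simplex_at_vertex[OF simplexT] W by blast
    then show ?thesis
      using measure_triangle_Int_ball[of y b c] angle_at_triangle[of y b c "mat 1"]
      by (simp add: norm_eq_sqrt_inner)
  qed
  obtain d where d': "\<forall>K\<in>?W. d K > 0 \<and> (\<forall>r. 0 < r \<and> r \<le> d K \<longrightarrow>
      measure lebesgue (K \<inter> ball y r) = r\<^sup>2 / 2 * angle_at (mat 1) K y)"
    using bchoice[OF ballI[OF ex]] by (rule exE)
  then have d: "\<And>K. K \<in> ?W \<Longrightarrow> d K > 0"
    "\<And>K r. K \<in> ?W \<Longrightarrow> 0 < r \<Longrightarrow> r \<le> d K \<Longrightarrow>
      measure lebesgue (K \<inter> ball y r) = r\<^sup>2 / 2 * angle_at (mat 1) K y"
    by blast+
  define r where "r = Min (insert d0 (d ` ?W))"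
  have r: "r > 0" "r \<le> d0" "\<And>K. K \<in> ?W \<Longrightarrow> r \<le> d K"
    using d0 d(1) finW by (auto simp: r_def)
  have ball: "ball y r = (\<Union>K\<in>?W. K \<inter> ball y r)"
  proof (intro equalityI subsetI)
    fix x assume x: "x \<in> ball y r"
    then have "x \<in> ball y d0" using r(2) by auto
    then have x0: "x \<in> \<Omega> - \<Union>{K \<in> T. y \<notin> K}" using d0(2) by blast
    then obtain K where K: "K \<in> T" "x \<in> K" using UnionT closure_subset by blast
    then have "K \<in> ?W" using x0 extreme_point_of_cell[OF y(1)] by blast
    then show "x \<in> (\<Union>K\<in>?W. K \<inter> ball y r)" using x K by blast
  qed auto
  have "r\<^sup>2 * pi = measure lebesgue (ball y r)"
    using circle_area[of r y] r by simp
  also have "\<dots> = measure lebesgue (\<Union>K\<in>?W. K \<inter> ball y r)" using ball by simp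
  also have "\<dots> = (\<Sum>K\<in>?W. measure lebesgue (K \<inter> ball y r))"
  proof (rule measure_negligible_finite_Union_image[OF finW])
    show "K \<inter> ball y r \<in> lmeasurable" if "K \<in> ?W" for K
      using that compact_cell by (intro fmeasurable.Int lmeasurable_compact lmeasurable_ball) auto
    show "pairwise (\<lambda>K K'. negligible (K \<inter> ball y r \<inter> (K' \<inter> ball y r))) ?W"
      unfolding pairwise_def using negligible_Int_cells
      by (auto intro: negligible_subset[of "_ \<inter> _"])
  qed
  also have "\<dots> = (\<Sum>K\<in>?W. r\<^sup>2 / 2 * angle_at (mat 1) K y)"
    using d(2) r by (intro sum.cong) auto
  also have "\<dots> = r\<^sup>2 / 2 * (\<Sum>K\<in>?W. angle_at (mat 1) K y)"
    by (rule sum_distrib_left[symmetric])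
  finally show ?thesis using r(1) by (simp add: field_simps)
qed

text \<open>Two triangles on the same side of the edge would overlap in a half disc around its
  midpoint, which is not negligible. On opposite sides they fill a disc around the midpoint, which
  puts the midpoint into \<open>interior (closure \<Omega>) = \<Omega>\<close> and hence off the
  frontier. Whether the counterclockwise directions of the edge agree decides between the two
  cases.\<close>

lemma shared_edge_inner:
  assumes K: "K1 \<in> T" "K2 \<in> T" "K1 \<noteq> K2" and e: "e edge_of K1" "e edge_of K2"
  shows "e \<in> inner_edges T \<Omega>"
proof (rule ccontr)
  assume "e \<notin> inner_edges T \<Omega>"
  then have fr: "e \<subseteq> frontier \<Omega>" using K e unfolding inner_edges_def edges_def by blast
  obtain a b c where 1: "orient a b c > 0" "K1 = convex hull {a,b,c}" "e = closed_segment a b"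
    using two_simplex_at_edge[OF simplexT] K e by metis
  obtain a' b' c' where 2: "orient a' b' c' > 0" "K2 = convex hull {a',b',c'}" "e = closed_segment a' b'"
    using two_simplex_at_edge[OF simplexT] K e by metis
  let ?m = "midpoint a b"
  obtain d1 where d1: "d1 > 0" "\<And>x. x \<in> ball ?m d1 \<Longrightarrow> orient a b x \<ge> 0 \<Longrightarrow> x \<in> K1"
    using halfball_subset_triangle[OF 1(1)] 1 by blast
  obtain d2 where d2: "d2 > 0" "\<And>x. x \<in> ball (midpoint a' b') d2 \<Longrightarrow> orient a' b' x \<ge> 0 \<Longrightarrow> x \<in> K2"
    using halfball_subset_triangle[OF 2(1)] 2 by blast
  define d where "d = min d1 d2"
  have d: "d > 0" "d \<le> d1" "d \<le> d2" using d1 d2 by (auto simp: d_def)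
  consider "a' = a" "b' = b" | "a' = b" "b' = a"
    using 1(3) 2(3) by (auto simp: doubleton_eq_iff)
  then show False
  proof cases
    case 1
    let ?U = "ball ?m d \<inter> {x. orient a b x > 0}"
    have U: "?U \<subseteq> K1 \<inter> K2" using d d1 d2 1 by auto
    have m: "orient a b ?m = 0" by (simp add: orient_simps midpoint_def field_simps)
    \<comment> \<open>A short step from the midpoint towards \<open>c\<close> gives a point of the
      half disc; the summand 1 keeps the denominator positive.\<close>
    obtain s :: real where s: "s > 0" "dist ?m (?m + s *\<^sub>R (c - ?m)) < d"
    proof
      show "d / 2 / (norm (c - ?m) + 1) > 0" using d by (simp add: add_nonneg_pos)
      have "norm (c - ?m) / (norm (c - ?m) + 1) \<le> 1" by (simp add: divide_le_eq add_nonneg_pos)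
      then have "d / 2 * (norm (c - ?m) / (norm (c - ?m) + 1)) < d"
        using d mult_left_le[of "norm (c - ?m) / (norm (c - ?m) + 1)" "d / 2"] by linarith
      then show "dist ?m (?m + (d / 2 / (norm (c - ?m) + 1)) *\<^sub>R (c - ?m)) < d"
        using d by (simp add: dist_norm)
    qed
    have "orient a b (?m + s *\<^sub>R (c - ?m)) = (1 - s) * orient a b ?m + s * orient a b c"
      by (simp add: orient_simps algebra_simps)
    then have "orient a b (?m + s *\<^sub>R (c - ?m)) > 0" using m s \<open>orient a b c > 0\<close> by simp
    then have "?U \<noteq> {}" using s by auto
    moreover have "open ?U"
      unfolding orient_simps by (intro open_Int open_ball open_Collect_less continuous_intros)
    ultimately have "\<not> negligible ?U" by (rule open_not_negligible[rotated])
    then show False using U negligible_Int_cells[OF K] negligible_subset by blast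
  next
    case 2
    have "ball ?m d \<subseteq> K1 \<union> K2"
    proof
      fix x assume x: "x \<in> ball ?m d"
      have "orient b a x = - orient a b x" by (simp add: orient_simps algebra_simps)
      then consider "orient a b x \<ge> 0" | "orient a' b' x \<ge> 0" using 2 by fastforce
      then show "x \<in> K1 \<union> K2"
        using x d d1(2)[of x] d2(2)[of x] 2 midpoint_sym[of a b] by cases auto
    qed
    then have "ball ?m d \<subseteq> closure \<Omega>" using K UnionT by blast
    then have "?m \<in> interior (closure \<Omega>)" using d(1) mem_interior by blast
    moreover have "?m \<in> e" unfolding \<open>e = closed_segment a b\<close> by (rule midpoint_in_closed_segment)
    ultimately show False
      using fr open_domain unfolding interior_closure_domain frontier_def
      by (auto simp: interior_open)
  qed
qed

end


section \<open>The form for piecewise constant metrics\<close>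

text \<open>A triangle is the closure of its interior, so the sets over which the means are taken
  have positive measure. Every mean then equals \<open>c\<close>, and the limit is that of a
  constant.\<close>

lemma tr_eq_const:
  assumes K: "2 simplex K" "x \<in> K" and f: "\<And>y. y \<in> interior K \<Longrightarrow> f y = c"
  shows "tr K f x = c"
proof -
  have "(LINT y|lebesgue_on (interior K \<inter> ball x r). f y) / measure lebesgue (interior K \<inter> ball x r) = c"
    if "r > 0" for r
  proof -
    let ?A = "interior K \<inter> ball x r"
    have "x \<in> closure (interior K)" using two_simplex_interior K by blast
    then have "?A \<noteq> {}" using that closure_approachable[of x "interior K"] by (force simp: dist_commute)
    then have nn: "\<not> negligible ?A" by (intro open_not_negligible) auto
    have lm: "?A \<in> lmeasurable"
      by (intro lmeasurable_open) (auto intro: bounded_subset[of "ball x r"])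
    then have pos: "measure lebesgue ?A \<noteq> 0"
      using nn negligible_iff_measure by blast
    have "(LINT y|lebesgue_on ?A. f y) = (LINT y|lebesgue_on ?A. c)"
      by (rule Bochner_Integration.integral_cong) (auto simp: f)
    also have "\<dots> = measure lebesgue ?A * c"
      using lm by (simp add: measure_restrict_space fmeasurableD)
    finally show ?thesis using pos by simp
  qed
  then have "((\<lambda>r. (LINT y|lebesgue_on (interior K \<inter> ball x r). f y) /
      measure lebesgue (interior K \<inter> ball x r)) \<longlongrightarrow> c) (at_right 0)"
    by (intro tendsto_eventually eventually_at_rightI[of 0 1]) auto
  then show ?thesis unfolding tr_def by (intro tendsto_Lim) auto
qed

lemma mtr_eq_const:
  assumes "2 simplex K" "x \<in> K" "\<And>y. y \<in> interior K \<Longrightarrow> \<sigma> y = A"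
  shows "mtr K \<sigma> x = A"
  unfolding mtr_def using assms by (simp add: tr_eq_const[of K x _ "A $ i $ j" for i j] vec_eq_iff)

lemma frechet_derivative_affine_on:
  assumes U: "open U" "x \<in> U" and v: "\<And>x. x \<in> U \<Longrightarrow> v x = l \<bullet> x + k"
  shows "(v has_derivative (\<lambda>h. l \<bullet> h)) (at x)" "partial i v x = l $ i"
proof -
  have "((\<lambda>x. l \<bullet> x + k) has_derivative (\<lambda>h. l \<bullet> h)) (at x)"
    by (auto intro!: derivative_eq_intros)
  then show D: "(v has_derivative (\<lambda>h. l \<bullet> h)) (at x)"
    by (rule has_derivative_transform_within_open[OF _ U]) (simp add: v)
  show "partial i v x = l $ i"
    unfolding partial_def frechet_derivative_at[OF D, symmetric] by (simp add: inner_axis)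
qed

text \<open>An affine function is continuously differentiable on \<open>U\<close>, so
  \<open>pd\<close> takes its classical branch instead of an arbitrarily chosen weak
  derivative.\<close>

lemma pd_affine_on:
  assumes U: "open U" "x \<in> U" and v: "\<And>x. x \<in> U \<Longrightarrow> v x = l \<bullet> x + k"
  shows "pd U i v x = l $ i"
proof -
  have "continuous_on U (partial j v)" for j
    by (rule continuous_on_eq[of _ "\<lambda>x. l $ j"])
      (auto simp: frechet_derivative_affine_on(2)[OF U(1) _ v])
  moreover have "v differentiable (at z)" if "z \<in> U" for z
    using frechet_derivative_affine_on(1)[OF U(1) that v] by (auto simp: differentiable_def)
  ultimately have "Ck_on 1 U v" by simp
  then show ?thesis
    unfolding pd_def using frechet_derivative_affine_on(2)[OF U v] by simp
qed

lemma pd_const_on: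
  assumes "open U" "x \<in> U" "\<And>x. x \<in> U \<Longrightarrow> v x = k"
  shows "pd U i v x = 0"
  using pd_affine_on[of U x v 0 k i] assms by simp

lemma hess_eq_0:
  assumes U: "open U" "x \<in> U" and v: "\<And>x. x \<in> U \<Longrightarrow> v x = l \<bullet> x + k"
    and G: "\<And>x. x \<in> U \<Longrightarrow> G x = B"
  shows "hess U G v x = 0"
proof -
  have "christoffel U G x k i j = 0" for k i j
    unfolding christoffel_def
    by (simp add: pd_const_on[OF U, of "\<lambda>z. G z $ a $ b" "B $ a $ b" for a b] G)
  moreover have "pd U i (pd U j v) x = 0" for i j
    by (rule pd_const_on[OF U, of _ "l $ j"]) (rule pd_affine_on[OF U(1) _ v])
  ultimately show ?thesis by (simp add: hess_def vec_eq_iff)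
qed

lemma grad_trace_affine:
  assumes "2 simplex K" "x \<in> K" "\<And>x. x \<in> interior K \<Longrightarrow> v x = l \<bullet> x + k"
  shows "grad_trace K v x = l"
proof -
  have "tr K (pd (interior K) i v) x = l $ i" for i
    using assms by (intro tr_eq_const) (auto intro: pd_affine_on)
  then show ?thesis by (simp add: grad_trace_def vec_eq_iff)
qed

text \<open>\<open>edge_integral\<close> may pick the endpoints in either order, but neither the
  length nor a constant integrand depends on it.\<close>

lemma edge_integral_const:
  assumes "\<And>x. x \<in> closed_segment a b \<Longrightarrow> f x = c"
  shows "edge_integral (closed_segment a b) f = norm (b - a) * c"
proof -
  obtain a' b' where ab: "(SOME (a', b'). closed_segment a b = closed_segment a' b') = (a', b')"
    by (metis surj_pair)
  have "case (SOME (a', b'). closed_segment a b = closed_segment a' b') of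
      (a', b') \<Rightarrow> closed_segment a b = closed_segment a' b'"
    by (rule someI[of _ "(a, b)"]) simp
  then have eq: "closed_segment a b = closed_segment a' b'" unfolding ab by simp
  have "(LINT s|lebesgue_on {0..1}. f (linepath a' b' s)) = (LINT s|lebesgue_on {0..1::real}. c)"
    by (rule Bochner_Integration.integral_cong)
      (auto intro!: assms simp: eq linepath_in_path)
  also have "\<dots> = c" by (simp add: measure_restrict_space)
  finally have "edge_integral (closed_segment a b) f = norm (b' - a') * c"
    unfolding edge_integral_def ab by simp
  moreover have "norm (b' - a') = norm (b - a)"
    using eq by (auto simp: doubleton_eq_iff norm_minus_commute)
  ultimately show ?thesis by simp
qed

text \<open>The integral of 1 is the length of the edge, which avoids naming endpoints. For an edge
  of a triangle this is the edge traversed counterclockwise.\<close>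

definition edge_vector :: "plane set \<Rightarrow> plane set \<Rightarrow> plane" where
  "edge_vector K e = edge_integral e (\<lambda>_. 1) *\<^sub>R tangent K e"

lemma edge_vector_triangle:
  assumes "orient a b c > 0"
  shows "edge_vector (convex hull {a,b,c}) (closed_segment a b) = b - a"
  unfolding edge_vector_def tangent_triangle[OF assms] edge_integral_const[where c=1, OF refl]
  using orient_nondegenerate(1)[OF assms] by (simp add: sgn_div_norm)

section \<open>Metrics on the segment from the identity to a positive definite matrix\<close>

definition interpolate :: "mat2 \<Rightarrow> real \<Rightarrow> mat2" where
  "interpolate A t = (1 - t) *\<^sub>R mat 1 + t *\<^sub>R A"

lemma interpolate_mult: "interpolate A t *v x = (1 - t) *\<^sub>R x + t *\<^sub>R (A *v x)"
  by (simp add: interpolate_def matrix_vector_mult_add_rdistrib scaleR_matrix_vector_assoc[symmetric])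

definition spd :: "mat2 \<Rightarrow> bool" where
  "spd A \<longleftrightarrow> transpose A = A \<and> (\<forall>w. w \<noteq> 0 \<longrightarrow> w \<bullet> (A *v w) > 0)"

lemma spd_interpolate:
  assumes "spd A" "t \<in> {0..1}"
  shows "spd (interpolate A t)"
proof -
  have "transpose (interpolate A t) = interpolate A t"
    using assms(1) by (simp add: spd_def interpolate_def transpose_def mat_def vec_eq_iff)
  moreover have "w \<bullet> (interpolate A t *v w) > 0" if "w \<noteq> 0" for w
  proof -
    have "w \<bullet> (A *v w) > 0" "w \<bullet> w > 0" using assms that by (auto simp: spd_def)
    then have "(1 - t) * (w \<bullet> w) + t * (w \<bullet> (A *v w)) > 0"
      using assms(2) by (cases "t = 0") (auto intro: add_nonneg_pos simp del: inner_gt_zero_iff)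
    then show ?thesis by (simp add: interpolate_mult inner_add_right)
  qed
  ultimately show ?thesis by (simp add: spd_def)
qed

lemma quadratic_form_plane:
  "x \<bullet> ((A::mat2) *v y) = x$1 * (A$1$1 * y$1 + A$1$2 * y$2) + x$2 * (A$2$1 * y$1 + A$2$2 * y$2)"
  by (simp add: inner_plane matrix_vector_mult_def sum_2)

lemma spd_det_pos:
  assumes "spd A"
  shows "det A > 0"
proof -
  have "transpose A $ 1 $ 2 = A $ 1 $ 2" using assms unfolding spd_def by simp
  then have s: "A$1$2 = A$2$1" by (simp add: transpose_def)
  have 1: "A$1$1 > 0"
  proof -
    have "vector [1, 0] \<noteq> (0::plane)" by (simp add: plane_eq_iff vector_2)
    then have "(vector [1, 0] :: plane) \<bullet> (A *v vector [1, 0]) > 0" using assms unfolding spd_def by blast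
    then show ?thesis unfolding quadratic_form_plane by (simp add: vector_2)
  qed
  \<comment> \<open>The first row of \<open>A\<close> annihilates this vector, so its quadratic form
    is \<open>A$1$1 * det A\<close>.\<close>
  have "vector [- A$1$2, A$1$1] \<noteq> (0::plane)" using 1 by (simp add: plane_eq_iff vector_2)
  then have "(vector [- A$1$2, A$1$1] :: plane) \<bullet> (A *v vector [- A$1$2, A$1$1]) > 0"
    using assms unfolding spd_def by blast
  then have "A$1$1 * det A > 0"
    unfolding quadratic_form_plane det_2 by (simp add: vector_2 s algebra_simps)
  then show ?thesis using 1 by (simp add: zero_less_mult_iff)
qed

lemma spd_matrix_inv:
  assumes "spd A"
  shows "A *v (matrix_inv A *v x) = x"
proof -
  have "\<exists>B. A ** B = mat 1 \<and> B ** A = mat 1"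
    using spd_det_pos[OF assms] invertible_det_nz[of A] unfolding invertible_def by simp
  then have "A ** matrix_inv A = mat 1" unfolding matrix_inv_def by (rule someI2_ex) blast
  then show ?thesis by (simp add: matrix_vector_mul_assoc)
qed

text \<open>The contribution of one edge of a triangle to \<open>b\<^sub>h\<close>, where \<open>E\<close> is the edge as a vector, traversed
  counterclockwise, and \<open>l\<close> is the gradient of \<open>v\<close>. By homogeneity in \<open>E\<close>, the length of the edge is
  absorbed when the unit tangent is replaced by \<open>E\<close>.\<close>

definition edge_form :: "mat2 \<Rightarrow> real \<Rightarrow> plane \<Rightarrow> plane \<Rightarrow> real" where
  "edge_form A t E l = (E \<bullet> (A *v E) - E \<bullet> E) / (E \<bullet> (interpolate A t *v E)) *
     ((Jmat *v (interpolate A t *v E)) \<bullet> l) / sqrt (det (interpolate A t))"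


lemma edge_form_0: "edge_form A t E 0 = 0"
  by (simp add: edge_form_def)

lemma edge_form_sum: "edge_form A t E (\<Sum>j\<in>I. c j *\<^sub>R l j) = (\<Sum>j\<in>I. c j * edge_form A t E (l j))"
  by (simp add: edge_form_def inner_sum_right sum_distrib_left sum_divide_distrib mult.assoc mult.left_commute)

text \<open>With \<open>q\<close> the length density, the two normalised tangents contribute
  \<open>1 / q\<^sup>2\<close>, the normal \<open>1 / q\<close> and the density \<open>q\<close>.
  The remaining quotient of quadratic forms does not change when the tangent is scaled, while the
  conormal is linear in it and absorbs \<open>s\<close>.\<close>

lemma edge_form_scale:
  assumes A: "spd A" "t \<in> {0..1}" and \<tau>: "norm \<tau> = 1" and s: "s > 0"
  defines "B \<equiv> interpolate A t"
  shows "s * ((g_tangent B \<tau> \<bullet> ((A - mat 1) *v g_tangent B \<tau>)) * (g_normal B \<tau> \<bullet> l) * sqrt (\<tau> \<bullet> (B *v \<tau>))) =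
    edge_form A t (s *\<^sub>R \<tau>) l"
proof -
  have B: "spd B" unfolding B_def using A by (rule spd_interpolate)
  have "\<tau> \<noteq> 0" using \<tau> by auto
  then have q: "\<tau> \<bullet> (B *v \<tau>) > 0" using B by (simp add: spd_def)
  let ?q = "sqrt (\<tau> \<bullet> (B *v \<tau>))"
  have q': "?q > 0" "?q * ?q = \<tau> \<bullet> (B *v \<tau>)" using q by auto
  have scale: "M *v (c *\<^sub>R x) = c *\<^sub>R (M *v x)" for M :: mat2 and c x
    by (rule matrix_vector_mult_scaleR)
  have tt: "g_tangent B \<tau> \<bullet> ((A - mat 1) *v g_tangent B \<tau>) = (\<tau> \<bullet> (A *v \<tau>) - \<tau> \<bullet> \<tau>) / (?q * ?q)"
    by (simp add: g_tangent_def scale matrix_vector_mult_diff_rdistrib inner_diff_right diff_divide_distrib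
        del: real_sqrt_mult_self)
  have n: "g_normal B \<tau> \<bullet> l = ((Jmat *v (B *v \<tau>)) \<bullet> l) / (?q * sqrt (det B))"
    by (simp add: g_normal_def)
  have "s * ((g_tangent B \<tau> \<bullet> ((A - mat 1) *v g_tangent B \<tau>)) * (g_normal B \<tau> \<bullet> l) * ?q) =
    s * ((\<tau> \<bullet> (A *v \<tau>) - \<tau> \<bullet> \<tau>) / (?q * ?q)) * ((Jmat *v (B *v \<tau>)) \<bullet> l) / sqrt (det B)"
    unfolding tt n using q' by simp
  also have "\<dots> = edge_form A t (s *\<^sub>R \<tau>) l"
  proof -
    have "(s * (s * (\<tau> \<bullet> (A *v \<tau>))) - s * (s * (\<tau> \<bullet> \<tau>))) / (s * (s * (\<tau> \<bullet> (B *v \<tau>)))) =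
      (\<tau> \<bullet> (A *v \<tau>) - \<tau> \<bullet> \<tau>) / (\<tau> \<bullet> (B *v \<tau>))"
      using s q by (simp add: right_diff_distrib[symmetric])
    then show ?thesis
      unfolding edge_form_def B_def[symmetric] q'(2) by (simp add: scale)
  qed
  finally show ?thesis .
qed

context triangulated_domain
begin

lemma edge_cases:
  assumes "K \<in> T" "e edge_of K"
  obtains a b where "e = closed_segment a b" "a \<noteq> b" "e \<subseteq> K" "tangent K e = sgn (b - a)"
    "edge_integral e (\<lambda>_. 1) = norm (b - a)"
proof -
  obtain a b c where abc: "orient a b c > 0" "K = convex hull {a,b,c}" "e = closed_segment a b"
    using two_simplex_at_edge[OF simplexT] assms by metis
  show ?thesis
  proof
    show "e \<subseteq> K" using assms(2) by (rule edge_of_imp_subset)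
    show "tangent K e = sgn (b - a)" unfolding abc(2,3) by (rule tangent_triangle[OF abc(1)])
    show "edge_integral e (\<lambda>_. 1) = norm (b - a)"
      unfolding abc(3) using edge_integral_const[of a b "\<lambda>_. 1" 1] by simp
  qed (use abc orient_nondegenerate in auto)
qed

lemma finite_edges_of_cell: "K \<in> T \<Longrightarrow> finite {e. e edge_of K}"
  by (rule two_simplexE[OF simplexT]) (auto simp: edge_of_triangle_iff)

lemma finite_edges: "finite (edges T)"
proof -
  have "edges T = (\<Union>K\<in>T. {e. e edge_of K})" by (auto simp: edges_def)
  then show ?thesis using finite_T finite_edges_of_cell by simp
qed

text \<open>The factors outside the jump can be evaluated from any triangle at the edge, so they
  move into the sum over these triangles, and all integrands are constant along the edge. Exchanging
  the sums over edges and triangles then isolates each triangle.\<close>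

lemma bh_interpolate:
  assumes t: "t \<in> {0..1}"
    and A: "\<And>K. K \<in> T \<Longrightarrow> spd (A K)"
    and g: "\<And>K x. K \<in> T \<Longrightarrow> x \<in> interior K \<Longrightarrow> g x = A K"
    and tt: "\<And>K K' e. K \<in> T \<Longrightarrow> K' \<in> T \<Longrightarrow> e edge_of K \<Longrightarrow> e edge_of K' \<Longrightarrow>
      tangent K e \<bullet> (A K *v tangent K e) = tangent K' e \<bullet> (A K' *v tangent K' e)"
    and v: "\<And>K x. K \<in> T \<Longrightarrow> x \<in> interior K \<Longrightarrow> v x = L K \<bullet> x + k K"
  shows "bh T (\<lambda>x. (1 - t) *\<^sub>R mat 1 + t *\<^sub>R g x) (\<lambda>x. g x - mat 1) v =
    (\<Sum>K\<in>T. \<Sum>e | e edge_of K. edge_form (A K) t (edge_vector K e) (L K))"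
proof -
  let ?G = "\<lambda>x. interpolate (g x) t" and ?B = "\<lambda>K. interpolate (A K) t"
  let ?\<sigma> = "\<lambda>x. g x - mat 1"
  have G: "?G x = ?B K" if "K \<in> T" "x \<in> interior K" for K x using g[OF that] by simp
  have tri: "inner_tri ?G K \<rho> (hess (interior K) ?G v) = 0" if K: "K \<in> T" for K \<rho>
  proof -
    have "hess (interior K) ?G v x = 0" if "x \<in> interior K" for x
      by (rule hess_eq_0[OF open_interior that]) (use v G K in auto)
    then have "inner_tri ?G K \<rho> (hess (interior K) ?G v) = (LINT x|lebesgue_on (interior K). 0)"
      unfolding inner_tri_def by (intro Bochner_Integration.integral_cong) (auto simp: trace_def)
    then show ?thesis by simp
  qed
  have edge: "inner_edge T ?G e (tt_component T ?G ?\<sigma> e) (jump T e (normal_deriv ?G v e)) =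
      (\<Sum>K | K \<in> T \<and> e edge_of K. edge_form (A K) t (edge_vector K e) (L K))"
    if e: "e \<in> edges T" for e
  proof -
    define S where "S = side T e"
    have S: "S \<in> T" "e edge_of S"
    proof -
      have "\<exists>K. K \<in> T \<and> e edge_of K" using e by (auto simp: edges_def)
      then have "S \<in> T \<and> e edge_of S" unfolding S_def side_def by (rule someI_ex)
      then show "S \<in> T" "e edge_of S" by auto
    qed
    obtain a b where ab: "e = closed_segment a b" "a \<noteq> b" using edge_cases[OF S] by metis
    have elen: "edge_integral e (\<lambda>_. 1) = norm (b - a)"
      unfolding ab(1) using edge_integral_const[of a b "\<lambda>_. 1" 1] by simp
    let ?s = "norm (b - a)"
    have s: "?s > 0" using ab by simp
    let ?\<tau> = "\<lambda>K. tangent K e"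
    let ?tt = "\<lambda>K. g_tangent (?B K) (?\<tau> K) \<bullet> ((A K - mat 1) *v g_tangent (?B K) (?\<tau> K))"
    let ?len = "\<lambda>K. sqrt (?\<tau> K \<bullet> (?B K *v ?\<tau> K))"
    have unit: "norm (?\<tau> K) = 1" if "K \<in> T" "e edge_of K" for K
      using that by (rule edge_cases) (simp add: norm_sgn)
    \<comment> \<open>The hypothesis \<open>tt\<close> concerns \<open>A\<close> only. Tangents are
      unit vectors, so the Euclidean form agrees as well, and with it every linear combination of
      the two, in particular those given by \<open>?B\<close> and by
      \<open>A K - mat 1\<close>.\<close>
    have same: "?\<tau> K \<bullet> (A K *v ?\<tau> K) = ?\<tau> S \<bullet> (A S *v ?\<tau> S)" "?\<tau> K \<bullet> ?\<tau> K = ?\<tau> S \<bullet> ?\<tau> S"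
      if "K \<in> T" "e edge_of K" for K
      using tt[OF that(1) S(1) that(2) S(2)] unit[OF that] unit[OF S] by (auto simp: norm_eq_1)
    have len: "?len S = ?len K" if "K \<in> T" "e edge_of K" for K
      using same[OF that] by (simp add: interpolate_mult inner_add_right)
    have tts: "?tt S = ?tt K" if "K \<in> T" "e edge_of K" for K
      unfolding g_tangent_def matrix_vector_mult_scaleR
      using same[OF that] len[OF that] by (simp add: matrix_vector_mult_diff_rdistrib inner_diff_right)
    let ?c = "\<Sum>K | K \<in> T \<and> e edge_of K. ?tt K * (g_normal (?B K) (?\<tau> K) \<bullet> L K) * ?len K"
    have "edge_integral e (\<lambda>x. tt_component T ?G ?\<sigma> e x * jump T e (normal_deriv ?G v e) x * length_density T ?G e x) = ?s * ?c"
      unfolding ab(1)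
    proof (rule edge_integral_const)
      fix x assume "x \<in> closed_segment a b"
      then have x: "x \<in> K" if "K \<in> T" "e edge_of K" for K
        using edge_of_imp_subset[OF that(2)] ab(1) by blast
      have mG: "mtr K ?G x = ?B K" if "K \<in> T" "e edge_of K" for K
        by (rule mtr_eq_const[OF simplexT x]) (use that G in auto)
      have ms: "mtr K ?\<sigma> x = A K - mat 1" if "K \<in> T" "e edge_of K" for K
        by (rule mtr_eq_const[OF simplexT x]) (use that g in auto)
      have 1: "tt_component T ?G ?\<sigma> e x = ?tt S"
        unfolding tt_component_def S_def[symmetric] Let_def mG[OF S] ms[OF S] ..
      have 2: "length_density T ?G e x = ?len S"
        unfolding length_density_def S_def[symmetric] Let_def mG[OF S] ..
      have 3: "normal_deriv ?G v e K x = g_normal (?B K) (?\<tau> K) \<bullet> L K" if "K \<in> T" "e edge_of K" for K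
      proof -
        have "grad_trace K v x = L K"
          by (rule grad_trace_affine[OF simplexT x]) (use that v in auto)
        \<comment> \<open>The metric cancels against its inverse and enters the normal derivative
          only through the normal.\<close>
        then show ?thesis
          unfolding normal_deriv_def Let_def mG[OF that]
          using spd_matrix_inv[OF spd_interpolate[OF A t]] that by simp
      qed
      have "tt_component T ?G ?\<sigma> e x * jump T e (normal_deriv ?G v e) x * length_density T ?G e x =
        ?tt S * (\<Sum>K | K \<in> T \<and> e edge_of K. g_normal (?B K) (?\<tau> K) \<bullet> L K) * ?len S"
        unfolding 1 2 jump_def using 3 by simp
      also have "\<dots> = (\<Sum>K | K \<in> T \<and> e edge_of K. ?tt S * (g_normal (?B K) (?\<tau> K) \<bullet> L K) * ?len S)"
        by (simp add: sum_distrib_left sum_distrib_right)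
      also have "\<dots> = ?c"
        using tts len by (intro sum.cong) auto
      finally show "tt_component T ?G ?\<sigma> (closed_segment a b) x *
          jump T (closed_segment a b) (normal_deriv ?G v (closed_segment a b)) x *
          length_density T ?G (closed_segment a b) x =
        (\<Sum>K | K \<in> T \<and> closed_segment a b edge_of K.
          (g_tangent (?B K) (tangent K (closed_segment a b)) \<bullet>
            ((A K - mat 1) *v g_tangent (?B K) (tangent K (closed_segment a b)))) *
          (g_normal (?B K) (tangent K (closed_segment a b)) \<bullet> L K) *
          sqrt (tangent K (closed_segment a b) \<bullet> (?B K *v tangent K (closed_segment a b))))"
        unfolding ab(1) .
    qed
    also have "\<dots> = (\<Sum>K | K \<in> T \<and> e edge_of K. edge_form (A K) t (edge_vector K e) (L K))"
      unfolding sum_distrib_left edge_vector_def elen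
      using unit A t s by (intro sum.cong refl edge_form_scale) auto
    finally show ?thesis unfolding inner_edge_def .
  qed
  have "bh T ?G ?\<sigma> v = (\<Sum>e\<in>edges T. \<Sum>K | K \<in> T \<and> e edge_of K. edge_form (A K) t (edge_vector K e) (L K))"
    unfolding bh_def using tri edge by simp
  also have "\<dots> = (\<Sum>K\<in>T. \<Sum>e | e \<in> edges T \<and> e edge_of K. edge_form (A K) t (edge_vector K e) (L K))"
    by (rule sum.swap_restrict[OF finite_edges finite_T])
  also have "\<dots> = (\<Sum>K\<in>T. \<Sum>e | e edge_of K. edge_form (A K) t (edge_vector K e) (L K))"
    by (intro sum.cong) (auto simp: edges_def)
  finally show ?thesis by (simp add: interpolate_def)
qed

end


section \<open>Derivatives of angles\<close>

text \<open>The hypothesis on \<open>s\<close> says that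
  \<open>s / (sqrt (a t) * sqrt (b t))\<close> is the sine of the angle. Being positive, it keeps
  the argument of \<open>arccos\<close> where the function is differentiable, and it removes all
  square roots from the derivative.\<close>

lemma DERIV_arccos_cosine:
  assumes a: "(a has_real_derivative a') (at t)" "a t > 0"
    and b: "(b has_real_derivative b') (at t)" "b t > 0"
    and c: "(c has_real_derivative c') (at t)"
    and s: "s > 0" "a t * b t - (c t)\<^sup>2 = s\<^sup>2"
  shows "((\<lambda>t. arccos (c t / (sqrt (a t) * sqrt (b t)))) has_real_derivative
    - (c' - c t / 2 * (a' / a t + b' / b t)) / s) (at t)"
proof -
  define p q where "p = sqrt (a t)" and "q = sqrt (b t)"
  have pq: "p > 0" "q > 0" "a t = p\<^sup>2" "b t = q\<^sup>2" using a b by (auto simp: p_def q_def)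
  define f' where "f' = (c' * (p * q) - c t * (inverse p / 2 * a' * q + inverse q / 2 * b' * p)) / (p * q * (p * q))"
  have 1: "((\<lambda>t. c t / (sqrt (a t) * sqrt (b t))) has_real_derivative f') (at t)"
  proof -
    have sa: "((\<lambda>t. sqrt (a t)) has_real_derivative inverse p / 2 * a') (at t)"
      unfolding p_def by (rule DERIV_chain2[OF DERIV_real_sqrt[OF a(2)] a(1)])
    have sb: "((\<lambda>t. sqrt (b t)) has_real_derivative inverse q / 2 * b') (at t)"
      unfolding q_def by (rule DERIV_chain2[OF DERIV_real_sqrt[OF b(2)] b(1)])
    have "sqrt (a t) * sqrt (b t) \<noteq> 0" using a b by simp
    from DERIV_divide[OF c DERIV_mult[OF sa sb] this] show ?thesis
      unfolding f'_def p_def q_def .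
  qed
  have x: "(c t / (p * q))\<^sup>2 = 1 - (s / (p * q))\<^sup>2"
    using s pq by (simp add: power_divide power_mult_distrib divide_simps)
  have spos: "s / (p * q) > 0" using s pq by simp
  then have "(c t / (p * q))\<^sup>2 < 1" using zero_less_power[OF spos, of 2] unfolding x by linarith
  then have lt: "-1 < c t / (p * q)" "c t / (p * q) < 1" unfolding abs_square_less_1 by linarith+
  have sq: "sqrt (1 - (c t / (p * q))\<^sup>2) = s / (p * q)"
    unfolding x using real_sqrt_abs[of "s / (p * q)"] spos by (simp del: real_sqrt_abs abs_divide)
  have "((\<lambda>t. arccos (c t / (sqrt (a t) * sqrt (b t)))) has_real_derivative
      inverse (- sqrt (1 - (c t / (p * q))\<^sup>2)) * f') (at t)"
    using DERIV_chain2[OF DERIV_arccos 1] lt unfolding p_def q_def by simp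
  moreover have "inverse (- sqrt (1 - (c t / (p * q))\<^sup>2)) * f' = - (c' - c t / 2 * (a' / a t + b' / b t)) / s"
    unfolding sq f'_def pq(3,4) using s(1) pq(1,2) by (simp add: field_simps power2_eq_square)
  ultimately show ?thesis by simp
qed

text \<open>The values \<open>-1\<close> characterise the gradient of a hat function, which falls
  from 1 at the common origin of \<open>u\<close> and \<open>w\<close> to 0 at their ends. Turned by
  ninety degrees, this gradient is parallel to the opposite edge \<open>w - u\<close>, with factor
  \<open>1 / cross2 u w\<close> up to sign.\<close>

lemma edge_form_hat:
  assumes D: "cross2 u w > 0" and l: "l \<bullet> u = -1" "l \<bullet> w = -1"
  shows "edge_form A t E l = - ((E \<bullet> (A *v E) - E \<bullet> E) / (E \<bullet> (interpolate A t *v E)) *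
    ((interpolate A t *v E) \<bullet> (w - u)) / (cross2 u w * sqrt (det (interpolate A t))))"
proof -
  have "(Jmat *v x) \<bullet> l = - (x \<bullet> (w - u)) / cross2 u w" for x
  proof -
    have "cross2 u w * ((Jmat *v x) \<bullet> l) = - (x \<bullet> ((l \<bullet> u) *\<^sub>R w - (l \<bullet> w) *\<^sub>R u)) * (-1)"
      by (simp add: cross2_def Jmat_def inner_plane matrix_vector_mult_def sum_2 vector_2 algebra_simps)
    then show ?thesis using D l by (simp add: field_simps inner_diff_right)
  qed
  then show ?thesis unfolding edge_form_def by (simp add: mult.assoc)
qed

lemma triangle_edges_sum:
  assumes D: "orient p b c > 0"
  shows "(\<Sum>e | e edge_of (convex hull {p,b,c}). f (edge_vector (convex hull {p,b,c}) e)) =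
    f (b - p) + f (c - b) + f (p - c)"
proof -
  let ?K = "convex hull {p,b,c}"
  have D': "orient b c p > 0" "orient c p b > 0" using D orient_cycle by metis+
  have K: "?K = convex hull {b,c,p}" "?K = convex hull {c,p,b}"
    by (intro arg_cong[where f="\<lambda>S. convex hull S"], blast)+
  have "{e. e edge_of ?K} = {closed_segment p b, closed_segment b c, closed_segment c p}"
    using edge_of_triangle_iff[OF D] by blast
  moreover have "closed_segment p b \<noteq> closed_segment b c" "closed_segment p b \<noteq> closed_segment c p"
    "closed_segment b c \<noteq> closed_segment c p"
    using orient_nondegenerate[OF D] by (auto simp: doubleton_eq_iff)
  moreover have "edge_vector ?K (closed_segment p b) = b - p"
    by (rule edge_vector_triangle[OF D])
  moreover have "edge_vector ?K (closed_segment b c) = c - b"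
    unfolding K(1) by (rule edge_vector_triangle[OF D'(1)])
  moreover have "edge_vector ?K (closed_segment c p) = p - c"
    unfolding K(2) by (rule edge_vector_triangle[OF D'(2)])
  ultimately show ?thesis by (simp add: add.assoc)
qed

text \<open>In the notation of the proof, \<open>(x - z) / ?s\<close> and
  \<open>(y - z) / ?s\<close> are the cotangents of the angles at \<open>b\<close> and
  \<open>c\<close> measured by \<open>B\<close>. The identity for \<open>q' (w - u) (w - u)\<close>
  is the law of cosines differentiated in \<open>t\<close>; it expresses the derivative of the inner
  product of \<open>u\<close> and \<open>w\<close> through those of the squared side
  lengths.\<close>

lemma angle_derivative:
  assumes D: "orient p b c > 0" and A: "spd A" "t \<in> {0..1}"
    and l: "l \<bullet> (b - p) = -1" "l \<bullet> (c - p) = -1"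
  defines "K \<equiv> convex hull {p,b,c}"
  shows "((\<lambda>t. angle_at (interpolate A t) K p) has_real_derivative
    - (1 / 2) * (\<Sum>e | e edge_of K. edge_form A t (edge_vector K e) l)) (at t)"
proof -
  define u w where "u = b - p" and "w = c - p"
  define B where "B = interpolate A t"
  have B: "spd B" unfolding B_def using A by (rule spd_interpolate)
  have sym: "x \<bullet> (M *v y) = y \<bullet> (M *v x)" if "transpose M = M" for M :: mat2 and x y
    using dot_lmul_matrix[of x M y] that by (metis inner_commute transpose_matrix_vector)
  have At: "transpose A = A" using A by (simp add: spd_def)
  have trans: "transpose (interpolate A s) = interpolate A s" for s
    using At by (simp add: interpolate_def transpose_def mat_def vec_eq_iff)
  have Duw: "cross2 u w > 0" using D by (simp add: u_def w_def orient_def)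
  then have "u \<noteq> 0" "w \<noteq> 0" "w - u \<noteq> 0" by (auto simp: cross2_def)
  then have pos: "u \<bullet> (B *v u) > 0" "w \<bullet> (B *v w) > 0" "(w - u) \<bullet> (B *v (w - u)) > 0"
    using B by (auto simp: spd_def)
  define q where "q x y = (\<lambda>s. x \<bullet> (interpolate A s *v y))" for x y
  define q' where "q' x y = x \<bullet> (A *v y) - x \<bullet> y" for x y
  have dq: "(q x y has_real_derivative q' x y) (at t)" for x y
    unfolding q_def q'_def interpolate_mult inner_add_right inner_scaleR_right
    by (auto intro!: derivative_eq_intros)
  have angle: "angle_at (interpolate A s) K p = arccos (q u w s / (sqrt (q u u s) * sqrt (q w w s)))" for s
    unfolding K_def q_def u_def w_def by (rule angle_at_triangle[OF D trans])
  let ?s = "cross2 u w * sqrt (det B)"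
  have s: "?s > 0" using Duw spd_det_pos[OF B] by simp
  \<comment> \<open>A Gram determinant: measured by \<open>B\<close>, the squared area of the
    parallelogram of \<open>u\<close> and \<open>w\<close> is the Euclidean one times
    \<open>det B\<close>. This supplies the sine of the angle.\<close>
  have gram: "q u u t * q w w t - (q u w t)\<^sup>2 = ?s\<^sup>2"
  proof -
    have "transpose B $ 1 $ 2 = B $ 1 $ 2" using B unfolding spd_def by simp
    then have B21: "B$2$1 = B$1$2" by (simp add: transpose_def)
    have "q u u t * q w w t - (q u w t)\<^sup>2 = (cross2 u w)\<^sup>2 * det B"
      unfolding q_def B_def[symmetric] quadratic_form_plane det_2 cross2_def
      by (simp add: B21 power2_eq_square algebra_simps)
    then show ?thesis using spd_det_pos[OF B] by (simp add: power_mult_distrib)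
  qed
  have der: "((\<lambda>t. angle_at (interpolate A t) K p) has_real_derivative
    - (q' u w - q u w t / 2 * (q' u u / q u u t + q' w w / q w w t)) / ?s) (at t)"
    unfolding angle
    by (rule DERIV_arccos_cosine[OF dq _ dq _ dq s gram]) (use pos in \<open>simp_all add: q_def B_def\<close>)
  define x y z where "x = q u u t" and "y = q w w t" and "z = q u w t"
  have xyz: "x > 0" "y > 0" "x + y - 2 * z > 0"
    using pos sym[OF trans, of w t u]
    by (simp_all add: x_def y_def z_def q_def B_def matrix_vector_mult_diff_distrib inner_diff_left inner_diff_right)
  have e: "edge_form A t E l = - (q' E E / q E E t * ((interpolate A t *v E) \<bullet> (w - u)) / ?s)" for E
    unfolding edge_form_hat[OF Duw l[folded u_def w_def]] q_def q'_def B_def ..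
  have minus: "M *v (- x) = - (M *v x)" for M :: mat2 and x
    using matrix_vector_mult_scaleR[of M "-1" x] by simp
  have bc: "c - b = w - u" "p - c = - w" by (simp_all add: u_def w_def)
  have q'wu: "q' (w - u) (w - u) = q' u u + q' w w - 2 * q' u w"
    using sym[OF At, of w u]
    by (simp add: q'_def matrix_vector_mult_diff_distrib inner_diff_left inner_diff_right inner_commute)
  have qm: "q (- w) (- w) t = y" "q' (- w) (- w) = q' w w"
    by (simp_all add: q_def q'_def y_def minus)
  have v: "(interpolate A t *v u) \<bullet> (w - u) = z - x"
    "(interpolate A t *v (w - u)) \<bullet> (w - u) = q (w - u) (w - u) t"
    "(interpolate A t *v (- w)) \<bullet> (w - u) = - (y - z)"
    using sym[OF trans, of w t u]
    by (simp_all add: x_def y_def z_def q_def minus inner_diff_left inner_diff_right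
        inner_commute[of "_ *v _"])
  have Q: "q (w - u) (w - u) t > 0" using pos by (simp add: q_def B_def)
  have f1: "edge_form A t u l = - (q' u u / x * (z - x) / ?s)"
    unfolding e v by (simp add: x_def)
  \<comment> \<open>For the opposite edge the conormal pairing is the quadratic form of the edge
    itself and cancels the denominator.\<close>
  have f2: "edge_form A t (w - u) l = - ((q' u u + q' w w - 2 * q' u w) / ?s)"
    unfolding e v q'wu using Q by simp
  have f3: "edge_form A t (- w) l = q' w w / y * (y - z) / ?s"
    unfolding e v qm by (simp only: mult_minus_right minus_divide_left minus_minus)
  have "(\<Sum>e | e edge_of K. edge_form A t (edge_vector K e) l) =
      (- q' u u / x * (z - x) - (q' u u + q' w w - 2 * q' u w) + q' w w / y * (y - z)) / ?s"
    unfolding K_def triangle_edges_sum[OF D, where f="\<lambda>E. edge_form A t E l"] bc u_def[symmetric]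
    unfolding f1 f2 f3 add_divide_distrib diff_divide_distrib by simp
  also have "\<dots> = 2 * (q' u w - z / 2 * (q' u u / x + q' w w / y)) / ?s"
  proof -
    have "- q' u u / x * (z - x) - (q' u u + q' w w - 2 * q' u w) + q' w w / y * (y - z) =
      2 * (q' u w - z / 2 * (q' u u / x + q' w w / y))"
      using xyz by (simp add: field_simps)
    then show ?thesis by simp
  qed
  finally have S: "(\<Sum>e | e edge_of K. edge_form A t (edge_vector K e) l) =
    2 * (q' u w - z / 2 * (q' u u / x + q' w w / y)) / ?s" .
  have half: "- (1 / 2) * (2 * X / r) = - X / r" for X r :: real by simp
  show ?thesis unfolding S half x_def y_def z_def by (rule der)
qed

lemma interpolate_0: "interpolate A 0 = mat 1" and interpolate_1: "interpolate A 1 = A"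
  by (simp_all add: interpolate_def)

lemma integral_edge_forms:
  assumes D: "orient p b c > 0" and A: "spd A"
    and l: "l \<bullet> (b - p) = -1" "l \<bullet> (c - p) = -1"
  defines "K \<equiv> convex hull {p,b,c}"
  shows "((\<lambda>t. \<Sum>e | e edge_of K. edge_form A t (edge_vector K e) l) has_integral
    2 * (angle_at (mat 1) K p - angle_at A K p)) {0..1}"
proof -
  let ?f = "\<lambda>t. \<Sum>e | e edge_of K. edge_form A t (edge_vector K e) l"
  have "((\<lambda>t. -2 * angle_at (interpolate A t) K p) has_real_derivative ?f t) (at t within {0..1})"
    if "t \<in> {0..1}" for t
  proof -
    have "((\<lambda>t. -2 * angle_at (interpolate A t) K p) has_real_derivative ?f t) (at t)"
      using DERIV_cmult[OF angle_derivative[OF D A that l], of "-2"] unfolding K_def by simp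
    then show ?thesis by (rule has_field_derivative_at_within)
  qed
  then have "(?f has_integral -2 * angle_at (interpolate A 1) K p - (-2 * angle_at (interpolate A 0) K p)) {0..1}"
    by (intro fundamental_theorem_of_calculus)
      (auto simp: has_real_derivative_iff_has_vector_derivative)
  then show ?thesis by (simp add: interpolate_0 interpolate_1 algebra_simps)
qed

text \<open>Gives integrability in \<open>t\<close>: the Lebesgue integral that defines the
  curvature is split into sums and identified with the integral of the fundamental theorem.\<close>

lemma continuous_edge_form:
  assumes A: "spd A" and E: "E \<noteq> 0"
  shows "continuous_on {0..1} (\<lambda>t. edge_form A t E l)"
proof -
  have 1: "E \<bullet> (interpolate A t *v E) \<noteq> 0" "det (interpolate A t) > 0" if "t \<in> {0..1}" for t
    using spd_interpolate[OF A that] E spd_det_pos by (auto simp: spd_def order_less_imp_not_eq2)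
  have 3: "continuous_on {0..1} (\<lambda>t. M *v (interpolate A t *v E))" for M :: mat2
    unfolding interpolate_mult matrix_vector_right_distrib matrix_vector_mult_scaleR
    by (intro continuous_intros)
  have 4: "continuous_on {0..1} (\<lambda>t. interpolate A t *v E)"
    using 3[of "mat 1"] by simp
  have 5: "continuous_on {0..1} (\<lambda>t. det (interpolate A t))"
    unfolding det_2 interpolate_def vector_add_component vector_scaleR_component
    by (intro continuous_intros)
  show ?thesis
    unfolding edge_form_def
    using 1 by (intro continuous_intros 3 4 5) (auto simp: order_less_imp_not_eq2)
qed


section \<open>The discrete curvature\<close>

text \<open>In the inductive step, \<open>r\<close> is the new basis vector minus its projection to the old ones. The form
  pairs it to zero with the old ones and to a positive value with the new one, so that adding a
  multiple of \<open>r\<close> corrects the last equation.\<close>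

lemma positive_form_solvable:
  fixes B :: "'a \<Rightarrow> 'a \<Rightarrow> real"
  assumes "finite I"
    and "\<And>c. \<exists>i\<in>I. c i \<noteq> 0 \<Longrightarrow> (\<Sum>i\<in>I. \<Sum>j\<in>I. c i * c j * B i j) > 0"
  shows "\<exists>c. \<forall>j\<in>I. (\<Sum>i\<in>I. c i * B i j) = L j"
  using assms
proof (induction I arbitrary: L rule: finite_induct)
  case (insert k I)
  have "(\<Sum>i\<in>I. \<Sum>j\<in>I. c i * c j * B i j) > 0" if "\<exists>i\<in>I. c i \<noteq> 0" for c
  proof -
    let ?c = "c(k := 0)"
    have "(\<Sum>i\<in>insert k I. \<Sum>j\<in>insert k I. ?c i * ?c j * B i j) > 0"
      using that insert.hyps by (intro insert.prems) (auto intro!: bexI)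
    moreover have "(\<Sum>i\<in>insert k I. \<Sum>j\<in>insert k I. ?c i * ?c j * B i j) = (\<Sum>i\<in>I. \<Sum>j\<in>I. c i * c j * B i j)"
      using insert.hyps by (auto intro!: sum.cong)
    ultimately show ?thesis by simp
  qed
  note IH = insert.IH[OF this]
  obtain d where d: "\<forall>j\<in>I. (\<Sum>i\<in>I. d i * B i j) = B k j" using IH[of "B k"] by blast
  obtain e where e: "\<forall>j\<in>I. (\<Sum>i\<in>I. e i * B i j) = L j" using IH[of L] by blast
  define r where "r i = (if i = k then 1 else - d i)" for i
  define R where "R j = (\<Sum>i\<in>insert k I. r i * B i j)" for j
  have R: "R j = B k j - (\<Sum>i\<in>I. d i * B i j)" for j
  proof -
    have "(\<Sum>i\<in>I. r i * B i j) = - (\<Sum>i\<in>I. d i * B i j)"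
      using insert.hyps unfolding sum_negf[symmetric] by (intro sum.cong) (auto simp: r_def)
    then show ?thesis using insert.hyps by (simp add: R_def r_def)
  qed
  then have R0: "R j = 0" if "j \<in> I" for j using d that by simp
  have "(\<Sum>i\<in>insert k I. \<Sum>j\<in>insert k I. r i * r j * B i j) = (\<Sum>j\<in>insert k I. r j * R j)"
    unfolding R_def sum_distrib_left by (subst sum.swap) (simp only: mult.left_commute mult.assoc)
  also have "\<dots> = R k" using insert.hyps R0 by (simp add: r_def)
  finally have "R k > 0" using insert.prems[of r] by (auto simp: r_def)
  define s where "s = (L k - (\<Sum>i\<in>I. e i * B i k)) / R k"
  define c where "c i = (if i = k then 0 else e i) + s * r i" for i
  have c: "(\<Sum>i\<in>insert k I. c i * B i j) = (\<Sum>i\<in>I. e i * B i j) + s * R j" for j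
  proof -
    have "(\<Sum>i\<in>insert k I. c i * B i j) =
      (\<Sum>i\<in>insert k I. (if i = k then 0 else e i) * B i j) + s * R j"
      by (simp only: c_def R_def sum_distrib_left distrib_right sum.distrib mult.assoc)
    also have "(\<Sum>i\<in>insert k I. (if i = k then 0 else e i) * B i j) = (\<Sum>i\<in>I. e i * B i j)"
      using insert.hyps by (auto intro!: sum.cong)
    finally show ?thesis .
  qed
  have "\<forall>j\<in>insert k I. (\<Sum>i\<in>insert k I. c i * B i j) = L j"
    unfolding c using e R0 \<open>R k > 0\<close> by (auto simp: s_def)
  then show ?case by blast
qed simp

lemma polys_0: "p \<in> polys 0 \<Longrightarrow> \<exists>c. \<forall>x. p x = c"
  by (auto simp: polys_def)

lemma polys_1: "p \<in> polys 1 \<Longrightarrow> \<exists>l k. \<forall>x. p x = l \<bullet> x + k"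
proof -
  assume "p \<in> polys 1"
  then obtain c where p: "p = (\<lambda>x. \<Sum>a\<le>1. \<Sum>b\<le>1 - a. c a b * (x $ 1) ^ a * (x $ 2) ^ b)"
    unfolding polys_def by blast
  have "p x = vector [c 1 0, c 0 1] \<bullet> x + c 0 0" for x
    unfolding p by (simp add: inner_plane vector_2)
  then show ?thesis by blast
qed

section \<open>Piecewise constant Regge metrics\<close>

locale regge_metric = triangulated_domain +
  fixes N N0 :: nat and y :: "nat \<Rightarrow> plane" and \<phi> :: "nat \<Rightarrow> plane \<Rightarrow> real" and g :: "plane \<Rightarrow> mat2"
  assumes enum: "vertex_enumeration T \<Omega> N0 N y"
    and basis: "nodal_basis \<Omega> T N0 N y \<phi>"
    and metric: "g \<in> Sigma_h_plus \<Omega> T 0"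
begin

abbreviation A :: "plane set \<Rightarrow> mat2" where "A K \<equiv> cell_value K g"

lemma metric_on_cell:
  assumes K: "K \<in> T" "x \<in> interior K"
  shows "g x = A K"
proof -
  have "g z $ i $ j = g x $ i $ j" if z: "z \<in> interior K" for z i j
  proof -
    obtain p where p: "p \<in> polys 0" "\<forall>x\<in>interior K. g x $ i $ j = p x"
      using metric K(1) unfolding Sigma_h_plus_def Sigma_h_def by blast
    obtain c where "\<forall>x. p x = c" using polys_0[OF p(1)] by blast
    then show ?thesis using p(2) z K(2) by simp
  qed
  then have all: "\<forall>z\<in>interior K. g z = g x" unfolding vec_eq_iff by blast
  have "A K = g x" unfolding cell_value_def
  proof (rule the_equality)
    show "\<forall>z\<in>interior K. g z = g x" by (rule all)
  next
    fix B assume "\<forall>z\<in>interior K. g z = B"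
    then show "B = g x" using K(2) by simp
  qed
  then show ?thesis by simp
qed

lemma spd_cell_value:
  assumes K: "K \<in> T"
  shows "spd (A K)"
proof -
  obtain x where x: "x \<in> interior K" using two_simplex_interior(1)[OF simplexT[OF K]] by blast
  then have "transpose (g x) = g x" "\<And>w. w \<noteq> 0 \<Longrightarrow> w \<bullet> (g x *v w) > 0"
    using metric K interior_cell_subset[OF K]
    unfolding Sigma_h_plus_def Sigma_h_def Sigma_space_def by blast+
  then show ?thesis using metric_on_cell[OF K x] by (simp add: spd_def)
qed

text \<open>An edge of two different triangles is inner, so the continuity condition applies for
  almost every point of it. The traces of the metric do not depend on the point, hence the almost
  everywhere statement has no parameter left.\<close>

lemma tangential_continuity:
  assumes K: "K \<in> T" "K' \<in> T" and e: "e edge_of K" "e edge_of K'"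
  shows "tangent K e \<bullet> (A K *v tangent K e) = tangent K' e \<bullet> (A K' *v tangent K' e)"
proof (cases "K = K'")
  case False
  obtain a b where ab: "e = closed_segment a b" "e \<subseteq> K" "tangent K e = sgn (b - a)"
    using edge_cases[OF K(1) e(1)] by metis
  obtain a' b' where ab': "e = closed_segment a' b'" "e \<subseteq> K'" "tangent K' e = sgn (b' - a')"
    using edge_cases[OF K(2) e(2)] by metis
  let ?s = "sgn (b - a)"
  have "e \<in> inner_edges T \<Omega>" using shared_edge_inner[OF K False e] .
  then have "AE s in lebesgue_on {0..1}. ?s \<bullet> (mtr K g (linepath a b s) *v ?s) =
      ?s \<bullet> (mtr K' g (linepath a b s) *v ?s)"
    using metric K e unfolding ab(1) Sigma_h_plus_def Sigma_h_def Sigma_space_def by blast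
  then have "AE s in lebesgue_on {0..1::real}. ?s \<bullet> (A K *v ?s) = ?s \<bullet> (A K' *v ?s)"
  proof (rule AE_mp, intro AE_I2 impI)
    fix s :: real assume s: "s \<in> space (lebesgue_on {0..1})"
      and eq: "?s \<bullet> (mtr K g (linepath a b s) *v ?s) = ?s \<bullet> (mtr K' g (linepath a b s) *v ?s)"
    have "linepath a b s \<in> e" unfolding ab(1) using s by (auto intro!: linepath_in_path)
    then have "linepath a b s \<in> K" "linepath a b s \<in> K'" using ab(2) ab'(2) by blast+
    then have "mtr K g (linepath a b s) = A K" "mtr K' g (linepath a b s) = A K'"
      using K metric_on_cell simplexT by (blast intro: mtr_eq_const)+
    then show "?s \<bullet> (A K *v ?s) = ?s \<bullet> (A K' *v ?s)" using eq by simp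
  qed
  \<comment> \<open>The interval has positive measure, so a constant statement that holds almost
    everywhere is true.\<close>
  moreover have "ae_filter (lebesgue_on {0..1::real}) \<noteq> bot"
    unfolding ae_filter_eq_bot_iff by (simp add: emeasure_restrict_space)
  ultimately have eq: "?s \<bullet> (A K *v ?s) = ?s \<bullet> (A K' *v ?s)"
    by (simp add: eventually_const)
  \<comment> \<open>Seen from the two triangles the tangents may be opposite; the quadratic form
    ignores the sign.\<close>
  have "sgn (b' - a') = ?s \<or> sgn (b' - a') = - ?s"
    using ab(1) ab'(1) sgn_minus[of "b - a"] by (auto simp: doubleton_eq_iff)
  then have "sgn (b' - a') \<bullet> (A K' *v sgn (b' - a')) = ?s \<bullet> (A K' *v ?s)"
    using matrix_vector_mult_scaleR[of "A K'" "-1" ?s] by auto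
  then show ?thesis using eq unfolding ab(3) ab'(3) by simp
qed simp

section \<open>The finite element space and its nodal basis\<close>

lemma Vh_affine:
  assumes "v \<in> Vh \<Omega> T 1" "K \<in> T"
  shows "\<exists>l k. \<forall>x\<in>K. v x = l \<bullet> x + k"
proof -
  obtain p where "p \<in> polys 1" "\<forall>x\<in>K. v x = p x" using assms unfolding Vh_def by blast
  then show ?thesis using polys_1[of p] by metis
qed

lemma Vh_L2: "v \<in> Vh \<Omega> T 1 \<Longrightarrow> v \<in> L2 \<Omega>"
  unfolding Vh_def V_space_def H10_def weak_partial_def by blast

definition combination :: "(nat \<Rightarrow> real) \<Rightarrow> plane \<Rightarrow> real" where
  "combination c x = (\<Sum>i=1..N0. c i * \<phi> i x)"

lemma basis_mem: "i \<in> {1..N0} \<Longrightarrow> \<phi> i \<in> Vh \<Omega> T 1"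
  and nodal: "i \<in> {1..N0} \<Longrightarrow> j \<in> {1..N} \<Longrightarrow> \<phi> i (y j) = (if i = j then 1 else 0)"
  and N0N: "N0 < N"
  using basis enum unfolding nodal_basis_def vertex_enumeration_def by blast+

lemma Vh_eq: "Vh \<Omega> T 1 = range combination"
proof -
  have img: "(\<lambda>c x. \<Sum>i=1..N0. c i * \<phi> i x) ` ({1..N0} \<rightarrow>\<^sub>E UNIV) = Vh \<Omega> T 1"
    using basis unfolding nodal_basis_def bij_betw_def by blast
  have "combination c \<in> Vh \<Omega> T 1" for c
  proof -
    \<comment> \<open>The basis condition ranges over coefficient functions that are fixed outside
      the index set, so \<open>c\<close> is restricted to it.\<close>
    have "combination c = (\<lambda>x. \<Sum>i=1..N0. restrict c {1..N0} i * \<phi> i x)"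
      by (auto simp: combination_def intro!: sum.cong)
    then show ?thesis unfolding img[symmetric] by (intro image_eqI[of _ _ "restrict c {1..N0}"]) auto
  qed
  moreover have "\<exists>c. v = combination c" if "v \<in> Vh \<Omega> T 1" for v
    using that unfolding img[symmetric] by (auto simp: combination_def fun_eq_iff)
  ultimately show ?thesis by blast
qed

lemma combination_mem: "combination c \<in> Vh \<Omega> T 1"
  unfolding Vh_eq by blast

lemma combination_nodal: "i \<in> {1..N0} \<Longrightarrow> combination c (y i) = c i"
  unfolding combination_def using nodal N0N by (subst sum.remove[of _ i]) (auto intro!: sum.neutral)

section \<open>The weighted inner product on the finite element space\<close>

lemma sqrt_det_cell: "K \<in> T \<Longrightarrow> x \<in> interior K \<Longrightarrow> sqrt (det (g x)) > 0"
  using metric_on_cell spd_det_pos[OF spd_cell_value] by simp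

lemma AE_interiors: "AE x in lebesgue_on \<Omega>. x \<in> (\<Union>K\<in>T. interior K)"
proof -
  have \<Omega>: "\<Omega> \<in> sets lebesgue" using open_domain by (simp add: lborelD)
  have "\<Omega> - (\<Union>K\<in>T. interior K) \<in> null_sets (lebesgue_on \<Omega>)"
    using negligible_domain_minus_interiors \<Omega>
    by (subst null_sets_restrict_space) (auto simp: negligible_iff_null_sets)
  then have "AE x in lebesgue_on \<Omega>. x \<notin> \<Omega> - (\<Union>K\<in>T. interior K)" by (rule AE_not_in)
  then show ?thesis by (rule AE_mp) (auto intro!: AE_I2)
qed

text \<open>The product \<open>u x * v x\<close> is dominated by the sum of the squares, and the
  density takes finitely many values outside a null set. The bound is only claimed almost everywhere
  because the values of \<open>g\<close> on edges are not controlled.\<close>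

lemma integrable_product:
  assumes u: "u \<in> Vh \<Omega> T 1" and v: "v \<in> Vh \<Omega> T 1"
  shows "integrable (lebesgue_on \<Omega>) (\<lambda>x. u x * v x * sqrt (det (g x)))"
proof -
  have uv: "u \<in> borel_measurable (lebesgue_on \<Omega>)" "v \<in> borel_measurable (lebesgue_on \<Omega>)"
    "integrable (lebesgue_on \<Omega>) (\<lambda>x. (u x)\<^sup>2)" "integrable (lebesgue_on \<Omega>) (\<lambda>x. (v x)\<^sup>2)"
    using Vh_L2[OF u] Vh_L2[OF v] by (auto simp: L2_def)
  have "(\<lambda>x. g x $ i $ j) \<in> borel_measurable (lebesgue_on \<Omega>)" for i j
    using metric unfolding Sigma_h_plus_def Sigma_h_def Sigma_space_def L2_def by blast
  then have m: "(\<lambda>x. u x * v x * sqrt (det (g x))) \<in> borel_measurable (lebesgue_on \<Omega>)"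
    unfolding det_2 using uv by measurable
  \<comment> \<open>A sum of nonnegative terms dominates each of them and serves as a common
    bound.\<close>
  define M where "M = (\<Sum>K\<in>T. sqrt (det (A K)))"
  have nn: "0 \<le> sqrt (det (A K))" if "K \<in> T" for K
    using spd_det_pos[OF spd_cell_value[OF that]] by simp
  have M: "sqrt (det (A K)) \<le> M" if "K \<in> T" for K
    unfolding M_def using that nn finite_T by (intro member_le_sum) auto
  have bd: "AE x in lebesgue_on \<Omega>. norm (u x * v x * sqrt (det (g x))) \<le> norm (M * ((u x)\<^sup>2 + (v x)\<^sup>2))"
    using AE_interiors
  proof (rule AE_mp, intro AE_I2 impI)
    fix x assume "x \<in> (\<Union>K\<in>T. interior K)"
    then obtain K where K: "K \<in> T" "x \<in> interior K" by blast
    have 1: "\<bar>u x * v x\<bar> \<le> (u x)\<^sup>2 + (v x)\<^sup>2"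
    proof -
      have "2 * (\<bar>u x\<bar> * \<bar>v x\<bar>) \<le> (u x)\<^sup>2 + (v x)\<^sup>2"
        using sum_squares_bound[of "\<bar>u x\<bar>" "\<bar>v x\<bar>"] by (simp add: mult.assoc)
      moreover have "0 \<le> \<bar>u x\<bar> * \<bar>v x\<bar>" by simp
      ultimately show ?thesis unfolding abs_mult by linarith
    qed
    have "\<bar>u x * v x\<bar> * sqrt (det (A K)) \<le> ((u x)\<^sup>2 + (v x)\<^sup>2) * M"
      using 1 M[OF K(1)] nn[OF K(1)] by (intro mult_mono) auto
    moreover have "0 \<le> M" using M[OF K(1)] nn[OF K(1)] by linarith
    ultimately show "norm (u x * v x * sqrt (det (g x))) \<le> norm (M * ((u x)\<^sup>2 + (v x)\<^sup>2))"
      using metric_on_cell[OF K] nn[OF K(1)] by (simp add: abs_mult mult.commute)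
  qed
  have "integrable (lebesgue_on \<Omega>) (\<lambda>x. M * ((u x)\<^sup>2 + (v x)\<^sup>2))"
    using uv by simp
  then show ?thesis by (rule Bochner_Integration.integrable_bound[OF _ m bd])
qed

text \<open>If the integral vanished, the set of interior points of \<open>K\<close> where the
  affine function \<open>u\<close> is nonzero would be open and null, hence empty. Passing to the
  closure of the interior then reaches \<open>x0\<close>, which may well be a vertex.\<close>

lemma inner_dom_pos:
  assumes u: "u \<in> Vh \<Omega> T 1" and x0: "u x0 \<noteq> 0" "x0 \<in> K" and K: "K \<in> T"
  shows "inner_dom \<Omega> g u u > 0"
proof -
  let ?f = "\<lambda>x. u x * u x * sqrt (det (g x))"
  have nonneg: "AE x in lebesgue_on \<Omega>. 0 \<le> ?f x"
    using AE_interiors by (rule AE_mp) (auto intro!: AE_I2 mult_nonneg_nonneg[OF _ less_imp_le[OF sqrt_det_cell]])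
  then have ge: "inner_dom \<Omega> g u u \<ge> 0" unfolding inner_dom_def by (rule integral_nonneg_AE)
  have "inner_dom \<Omega> g u u \<noteq> 0"
  proof
    assume "inner_dom \<Omega> g u u = 0"
    then have "AE x in lebesgue_on \<Omega>. ?f x = 0"
      unfolding inner_dom_def integral_nonneg_eq_0_iff_AE[OF integrable_product[OF u u] nonneg] .
    then have AE: "AE x in lebesgue. x \<in> \<Omega> \<longrightarrow> ?f x = 0"
      using open_domain by (subst (asm) AE_restrict_space_iff) (auto simp: lborelD)
    obtain l k where lk: "\<forall>x\<in>K. u x = l \<bullet> x + k" using Vh_affine[OF u K] by blast
    let ?U = "interior K \<inter> {x. l \<bullet> x + k \<noteq> 0}"
    have U: "open ?U" by (intro open_Int open_Collect_neq continuous_intros) auto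
    have "AE x in lebesgue. x \<notin> ?U"
      using AE
    proof (rule AE_mp, intro AE_I2 impI notI)
      fix x assume *: "x \<in> \<Omega> \<longrightarrow> ?f x = 0" "x \<in> ?U"
      then have "x \<in> \<Omega>" "x \<in> K" using interior_cell_subset[OF K] interior_subset by blast+
      then show False using * lk sqrt_det_cell[OF K, of x] by auto
    qed
    then have "negligible ?U"
      using U by (simp add: negligible_iff_null_sets AE_iff_null_sets lborelD)
    then have "?U = {}" using U open_not_negligible by blast
    then have "interior K \<subseteq> {x. l \<bullet> x + k = 0}" by blast
    moreover have "closed {x. l \<bullet> x + k = 0}" by (intro closed_Collect_eq continuous_intros)
    ultimately have "closure (interior K) \<subseteq> {x. l \<bullet> x + k = 0}" by (rule closure_minimal)
    then show False
      using x0 lk two_simplex_interior(2)[OF simplexT[OF K]] by auto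
  qed
  then show ?thesis using ge by simp
qed

lemma inner_dom_combination:
  assumes v: "v \<in> Vh \<Omega> T 1"
  shows "inner_dom \<Omega> g (combination c) v = (\<Sum>i=1..N0. c i * inner_dom \<Omega> g (\<phi> i) v)"
    and "inner_dom \<Omega> g v (combination c) = (\<Sum>i=1..N0. c i * inner_dom \<Omega> g v (\<phi> i))"
proof -
  have "inner_dom \<Omega> g (combination c) v =
    (LINT x|lebesgue_on \<Omega>. (\<Sum>i=1..N0. c i * (\<phi> i x * v x * sqrt (det (g x)))))"
    unfolding inner_dom_def combination_def by (simp add: sum_distrib_right mult.assoc)
  also have "\<dots> = (\<Sum>i=1..N0. c i * inner_dom \<Omega> g (\<phi> i) v)"
    unfolding inner_dom_def using integrable_product[OF basis_mem v]
    by (subst Bochner_Integration.integral_sum) auto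
  finally show 1: "inner_dom \<Omega> g (combination c) v = (\<Sum>i=1..N0. c i * inner_dom \<Omega> g (\<phi> i) v)" .
  have "inner_dom \<Omega> g u w = inner_dom \<Omega> g w u" for u w
    by (simp add: inner_dom_def mult.commute)
  then show "inner_dom \<Omega> g v (combination c) = (\<Sum>i=1..N0. c i * inner_dom \<Omega> g v (\<phi> i))"
    using 1 by simp
qed

text \<open>The quadratic form of the Gram matrix is the squared norm of the combination, and a
  nonzero coefficient is a nonzero nodal value at a vertex of some triangle.\<close>

lemma gram_pos:
  assumes "\<exists>i\<in>{1..N0}. c i \<noteq> 0"
  shows "(\<Sum>i=1..N0. \<Sum>j=1..N0. c i * c j * inner_dom \<Omega> g (\<phi> i) (\<phi> j)) > 0"
proof -
  obtain i where i: "i \<in> {1..N0}" "c i \<noteq> 0" using assms by blast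
  have "y i \<in> vertices T"
    using enum i N0N unfolding vertex_enumeration_def bij_betw_def by auto
  then obtain K where "K \<in> T" "y i \<in> K" unfolding vertices_def extreme_point_of_def by blast
  then have "inner_dom \<Omega> g (combination c) (combination c) > 0"
    using i combination_nodal by (intro inner_dom_pos[OF combination_mem, of _ "y i" K]) auto
  also have "inner_dom \<Omega> g (combination c) (combination c) =
    (\<Sum>i=1..N0. c i * (\<Sum>j=1..N0. c j * inner_dom \<Omega> g (\<phi> i) (\<phi> j)))"
    unfolding inner_dom_combination(1)[OF combination_mem]
    using inner_dom_combination(2)[OF basis_mem] by (intro sum.cong) auto
  finally show ?thesis by (simp add: sum_distrib_left mult.assoc)
qed

section \<open>The right-hand side of the curvature equation on hat functions\<close>

definition hat_grad :: "nat \<Rightarrow> plane set \<Rightarrow> plane" where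
  "hat_grad j K = (SOME l. \<exists>k. \<forall>x\<in>K. \<phi> j x = l \<bullet> x + k)"

lemma hat_affine:
  assumes "j \<in> {1..N0}" "K \<in> T"
  obtains k where "\<forall>x\<in>K. \<phi> j x = hat_grad j K \<bullet> x + k"
proof -
  have "\<exists>k. \<forall>x\<in>K. \<phi> j x = hat_grad j K \<bullet> x + k"
    unfolding hat_grad_def by (rule someI_ex) (rule Vh_affine[OF basis_mem[OF assms(1)] assms(2)])
  then show ?thesis using that by blast
qed

definition cell_form :: "nat \<Rightarrow> plane set \<Rightarrow> real \<Rightarrow> real" where
  "cell_form j K t = (\<Sum>e | e edge_of K. edge_form (A K) t (edge_vector K e) (hat_grad j K))"

lemma bh_combination:
  assumes t: "t \<in> {0..1}"
  shows "bh T (\<lambda>x. (1 - t) *\<^sub>R mat 1 + t *\<^sub>R g x) (\<lambda>x. g x - mat 1) (combination c) =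
    (\<Sum>j=1..N0. c j * (\<Sum>K\<in>T. cell_form j K t))"
proof -
  have "\<forall>j\<in>{1..N0}. \<forall>K\<in>T. \<exists>k. \<forall>x\<in>K. \<phi> j x = hat_grad j K \<bullet> x + k"
    using hat_affine by meson
  then obtain k where k: "\<And>j K x. j \<in> {1..N0} \<Longrightarrow> K \<in> T \<Longrightarrow> x \<in> K \<Longrightarrow> \<phi> j x = hat_grad j K \<bullet> x + k j K"
    by metis
  have "combination c x = (\<Sum>j=1..N0. c j *\<^sub>R hat_grad j K) \<bullet> x + (\<Sum>j=1..N0. c j * k j K)"
    if "K \<in> T" "x \<in> interior K" for K x
  proof -
    have "x \<in> K" using that(2) interior_subset by blast
    then have "combination c x = (\<Sum>j=1..N0. c j * (hat_grad j K \<bullet> x + k j K))"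
      unfolding combination_def using k that(1) by (intro sum.cong) auto
    then show ?thesis by (simp add: inner_sum_left sum.distrib distrib_left)
  qed
  then have "bh T (\<lambda>x. (1 - t) *\<^sub>R mat 1 + t *\<^sub>R g x) (\<lambda>x. g x - mat 1) (combination c) =
    (\<Sum>K\<in>T. \<Sum>e | e edge_of K. edge_form (A K) t (edge_vector K e) (\<Sum>j=1..N0. c j *\<^sub>R hat_grad j K))"
    by (intro bh_interpolate[OF t, where k="\<lambda>K. \<Sum>j=1..N0. c j * k j K"]
        spd_cell_value metric_on_cell tangential_continuity)
  also have "\<dots> = (\<Sum>K\<in>T. \<Sum>j=1..N0. c j * cell_form j K t)"
  proof (rule sum.cong[OF refl])
    fix K
    show "(\<Sum>e | e edge_of K. edge_form (A K) t (edge_vector K e) (\<Sum>j=1..N0. c j *\<^sub>R hat_grad j K)) =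
      (\<Sum>j=1..N0. c j * cell_form j K t)"
      unfolding edge_form_sum cell_form_def sum_distrib_left by (rule sum.swap)
  qed
  also have "\<dots> = (\<Sum>j=1..N0. c j * (\<Sum>K\<in>T. cell_form j K t))"
    unfolding sum_distrib_left by (rule sum.swap)
  finally show ?thesis .
qed

lemma continuous_cell_form:
  assumes K: "K \<in> T"
  shows "continuous_on {0..1} (cell_form j K)"
proof -
  have "edge_vector K e \<noteq> 0" if "e edge_of K" for e
    using edge_cases[OF K that] unfolding edge_vector_def by (metis norm_eq_zero right_minus_eq
        scaleR_eq_0_iff sgn_zero_iff)
  then show ?thesis
    unfolding cell_form_def using spd_cell_value[OF K] by (intro continuous_on_sum continuous_edge_form) auto
qed

definition functional :: "(plane \<Rightarrow> real) \<Rightarrow> real" where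
  "functional v = (1/2) * (LINT t|lebesgue_on {0..1}.
     bh T (\<lambda>x. (1 - t) *\<^sub>R mat 1 + t *\<^sub>R g x) (\<lambda>x. g x - mat 1) v)"

text \<open>Linearity is obtained from the explicit cell forms, not from \<open>bh\<close>, whose
  derivatives involve a choice operator.\<close>

lemma functional_combination:
  "functional (combination c) = (\<Sum>j=1..N0. c j * ((1/2) * (\<Sum>K\<in>T. integral {0..1} (cell_form j K))))"
proof -
  have int: "integrable (lebesgue_on {0..1}) (cell_form j K)" if "K \<in> T" for j K
    using continuous_cell_form[OF that] by (rule continuous_imp_integrable_real)
  have "functional (combination c) =
    (1/2) * (LINT t|lebesgue_on {0..1}. (\<Sum>j=1..N0. c j * (\<Sum>K\<in>T. cell_form j K t)))"
    unfolding functional_def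
    by (intro arg_cong[where f="\<lambda>r. (1/2) * r"] Bochner_Integration.integral_cong refl)
      (simp add: bh_combination del: One_nat_def)
  also have "\<dots> = (1/2) * (\<Sum>j=1..N0. c j * (\<Sum>K\<in>T. LINT t|lebesgue_on {0..1}. cell_form j K t))"
    using int by (simp add: Bochner_Integration.integral_sum)
  also have "\<dots> = (1/2) * (\<Sum>j=1..N0. c j * (\<Sum>K\<in>T. integral {0..1} (cell_form j K)))"
    using int by (simp add: lebesgue_integral_eq_integral)
  finally show ?thesis by (simp add: sum_distrib_left mult.left_commute)
qed

lemma basis_combination:
  "i \<in> {1..N0} \<Longrightarrow> \<phi> i = combination (\<lambda>j. if j = i then 1 else 0)"
  by (auto simp: combination_def fun_eq_iff if_distrib[of "\<lambda>c. c * _"] cong: if_cong)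

lemma functional_basis:
  assumes i: "i \<in> {1..N0}"
  shows "functional (\<phi> i) = (1/2) * (\<Sum>K\<in>T. integral {0..1} (cell_form i K))"
proof -
  have "functional (\<phi> i) = (\<Sum>j=1..N0. (if j = i then 1 else 0) * ((1/2) * (\<Sum>K\<in>T. integral {0..1} (cell_form j K))))"
    by (subst basis_combination[OF i]) (rule functional_combination)
  also have "\<dots> = (\<Sum>j=1..N0. if j = i then (1/2) * (\<Sum>K\<in>T. integral {0..1} (cell_form j K)) else 0)"
    by (intro sum.cong) auto
  finally show ?thesis using i by (simp only: sum.delta[OF finite_atLeastAtMost] if_True)
qed

text \<open>The definite description denotes because the positive Gram form gives both halves:
  solvability of the linear system for the coefficients, and uniqueness, since the coefficient
  difference \<open>r\<close> of two solutions has Gram form zero.\<close>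

lemma discrete_curvature_represents:
  assumes v: "v \<in> Vh \<Omega> T 1"
  shows "inner_dom \<Omega> g (discrete_curvature \<Omega> T 1 g) v = functional v"
proof -
  let ?P = "\<lambda>\<kappa>. \<kappa> \<in> Vh \<Omega> T 1 \<and> (\<forall>v\<in>Vh \<Omega> T 1. inner_dom \<Omega> g \<kappa> v = functional v)"
  have lin: "functional (combination c) = (\<Sum>j=1..N0. c j * functional (\<phi> j))" for c
    unfolding functional_combination by (rule sum.cong) (simp_all only: functional_basis)
  have "\<exists>d. \<forall>j\<in>{1..N0}. (\<Sum>i=1..N0. d i * inner_dom \<Omega> g (\<phi> i) (\<phi> j)) = functional (\<phi> j)"
    by (rule positive_form_solvable[OF finite_atLeastAtMost]) (rule gram_pos)
  then obtain d where d: "\<forall>j\<in>{1..N0}. (\<Sum>i=1..N0. d i * inner_dom \<Omega> g (\<phi> i) (\<phi> j)) = functional (\<phi> j)"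
    by blast
  have "?P (combination d)"
  proof (intro conjI ballI combination_mem)
    fix v assume "v \<in> Vh \<Omega> T 1"
    then obtain c where c: "v = combination c" unfolding Vh_eq by blast
    have "inner_dom \<Omega> g (combination d) v = (\<Sum>j=1..N0. c j * inner_dom \<Omega> g (combination d) (\<phi> j))"
      unfolding c by (rule inner_dom_combination(2)[OF combination_mem])
    also have "\<dots> = (\<Sum>j=1..N0. c j * functional (\<phi> j))"
      using d inner_dom_combination(1)[OF basis_mem] by (intro sum.cong) auto
    finally show "inner_dom \<Omega> g (combination d) v = functional v" unfolding c lin .
  qed
  moreover have "\<kappa> = combination d" if "?P \<kappa>" for \<kappa>
  proof -
    obtain c where c: "\<kappa> = combination c" using \<open>?P \<kappa>\<close> unfolding Vh_eq by blast
    define r where "r i = c i - d i" for i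
    have "(\<Sum>i=1..N0. r i * inner_dom \<Omega> g (\<phi> i) (\<phi> j)) = 0" if "j \<in> {1..N0}" for j
    proof -
      have "(\<Sum>i=1..N0. c i * inner_dom \<Omega> g (\<phi> i) (\<phi> j)) = functional (\<phi> j)"
        using \<open>?P \<kappa>\<close> basis_mem[OF that] inner_dom_combination(1)[OF basis_mem[OF that]] unfolding c by metis
      then show ?thesis using d that by (simp add: r_def left_diff_distrib sum_subtractf)
    qed
    then have "(\<Sum>j=1..N0. r j * (\<Sum>i=1..N0. r i * inner_dom \<Omega> g (\<phi> i) (\<phi> j))) = 0" by simp
    moreover have "(\<Sum>j=1..N0. r j * (\<Sum>i=1..N0. r i * inner_dom \<Omega> g (\<phi> i) (\<phi> j))) =
      (\<Sum>i=1..N0. \<Sum>j=1..N0. r i * r j * inner_dom \<Omega> g (\<phi> i) (\<phi> j))"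
      unfolding sum_distrib_left by (subst sum.swap) (simp only: mult.assoc mult.left_commute)
    ultimately have "\<not> (\<exists>i\<in>{1..N0}. r i \<noteq> 0)" using gram_pos[of r] by auto
    then show ?thesis unfolding c combination_def fun_eq_iff by (auto simp: r_def intro!: sum.cong)
  qed
  ultimately have "?P (THE \<kappa>. ?P \<kappa>)" by (rule theI)
  then show ?thesis
    using v unfolding discrete_curvature_def functional_def by blast
qed

text \<open>On a triangle at \<open>y i\<close> the hat function drops by 1 along both edges leaving
  \<open>y i\<close>, which is the situation of the angle derivative. On any other triangle it
  vanishes at all three vertices, so its gradient and the whole form vanish.\<close>

lemma integral_cell_form:
  assumes i: "i \<in> {1..N0}" and K: "K \<in> T"
  shows "integral {0..1} (cell_form i K) =
    (if y i extreme_point_of K then 2 * (angle_at (mat 1) K (y i) - angle_at (A K) K (y i)) else 0)"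
proof -
  obtain k where k: "\<forall>x\<in>K. \<phi> i x = hat_grad i K \<bullet> x + k" using hat_affine[OF i K] by blast
  let ?l = "hat_grad i K"
  have val: "?l \<bullet> p + k = (if p = y i then 1 else 0)" if p: "p extreme_point_of K" for p
  proof -
    have "p \<in> vertices T" using K p unfolding vertices_def by blast
    \<comment> \<open>The vertex may lie on the boundary, so the index runs up to \<open>N\<close>;
      the nodal values are prescribed there too.\<close>
    then obtain j where j: "j \<in> {1..N}" "p = y j"
      using enum unfolding vertex_enumeration_def bij_betw_def by blast
    have "inj_on y {1..N}" using enum unfolding vertex_enumeration_def bij_betw_def by blast
    moreover have "i \<in> {1..N}" using i N0N by auto
    ultimately have "p = y i \<longleftrightarrow> i = j" unfolding j(2) using inj_on_eq_iff[OF _ j(1)] by metis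
    moreover have "p \<in> K" using p unfolding extreme_point_of_def by blast
    ultimately show ?thesis using k nodal[OF i j(1)] j(2) by auto
  qed
  show ?thesis
  proof (cases "y i extreme_point_of K")
    case True
    obtain b c where D: "orient (y i) b c > 0" and KK: "K = convex hull {y i, b, c}"
      using two_simplex_at_vertex[OF simplexT[OF K] True] by blast
    have "?l \<bullet> p + k = (if p = y i then 1 else 0)" if "p \<in> {y i, b, c}" for p
      using vertices_of_triangle[OF D] that by (intro val) (auto simp: KK)
    from this[of "y i"] this[of b] this[of c]
    have "?l \<bullet> (b - y i) = -1" "?l \<bullet> (c - y i) = -1"
      using orient_nondegenerate[OF D] by (auto simp: inner_diff_right)
    then show ?thesis
      using integral_edge_forms[OF D spd_cell_value[OF K]] True
      unfolding cell_form_def[abs_def] KK[symmetric] by (simp add: integral_unique)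
  next
    case False
    obtain p b c where D: "orient p b c > 0" and KK: "K = convex hull {p, b, c}"
      using two_simplexE[OF simplexT[OF K]] by blast
    have "?l \<bullet> q + k = 0" if "q \<in> {p, b, c}" for q
    proof -
      have "q extreme_point_of K" using vertices_of_triangle[OF D] that by (auto simp: KK)
      then show ?thesis using val False by auto
    qed
    from this[of p] this[of b] this[of c]
    have 0: "?l \<bullet> (b - p) = 0" "?l \<bullet> (c - p) = 0" by (auto simp: inner_diff_right)
    have D': "cross2 (b - p) (c - p) \<noteq> 0" using D by (simp add: orient_def)
    \<comment> \<open>Orthogonal to a basis of the plane, the gradient is orthogonal to
      itself.\<close>
    have "?l \<bullet> ?l = 0"
      by (subst (2) cross2_expand[OF D', of ?l]) (simp add: inner_add_right 0)
    then have "cell_form i K = (\<lambda>t. 0)" by (simp add: cell_form_def[abs_def] edge_form_0)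
    then show ?thesis using False by simp
  qed
qed

lemma curvature_at_inner_vertex:
  assumes i: "i \<in> {1..N0}"
  shows "inner_dom \<Omega> g (discrete_curvature \<Omega> T 1 g) (\<phi> i) =
    2 * pi - (\<Sum>K | K \<in> T \<and> y i extreme_point_of K. angle_at (A K) K (y i))"
proof -
  have y: "y i \<in> vertices T" "y i \<notin> frontier \<Omega>"
    using enum i N0N unfolding vertex_enumeration_def bij_betw_def by auto
  have "inner_dom \<Omega> g (discrete_curvature \<Omega> T 1 g) (\<phi> i) =
    (1/2) * (\<Sum>K\<in>T. integral {0..1} (cell_form i K))"
    using discrete_curvature_represents[OF basis_mem[OF i]] functional_basis[OF i] by simp
  also have "\<dots> = (\<Sum>K\<in>T. if y i extreme_point_of K
      then angle_at (mat 1) K (y i) - angle_at (A K) K (y i) else 0)"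
    unfolding sum_distrib_left by (intro sum.cong) (auto simp: integral_cell_form[OF i])
  also have "\<dots> = (\<Sum>K | K \<in> T \<and> y i extreme_point_of K. angle_at (mat 1) K (y i) - angle_at (A K) K (y i))"
    by (rule sum.inter_filter[OF finite_T, symmetric])
  finally show ?thesis unfolding sum_subtractf sum_euclidean_angles[OF y] .
qed

end

theorem theorem3p2:
  fixes \<Omega> :: "plane set" and T :: "plane set set"
    and N N0 :: nat and y :: "nat \<Rightarrow> plane" and \<phi> :: "nat \<Rightarrow> plane \<Rightarrow> real"
    and g :: "plane \<Rightarrow> mat2" and i :: nat
  assumes "polygonal_domain \<Omega>"
    and "triangulates T \<Omega>"
    and "vertex_enumeration T \<Omega> N0 N y"
    and "nodal_basis \<Omega> T N0 N y \<phi>"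
    and "g \<in> Sigma_h_plus \<Omega> T 0"
    and "i \<in> {1..N0}"
  shows "inner_dom \<Omega> g (discrete_curvature \<Omega> T 1 g) (\<phi> i) =
    2 * pi - (\<Sum>K | K \<in> T \<and> y i extreme_point_of K. angle_at (cell_value K g) K (y i))"
proof -
  interpret regge_metric \<Omega> T N N0 y \<phi> g
    using assms by unfold_locales
  show ?thesis using curvature_at_inner_vertex[OF assms(6)] .
qed

end
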